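(* Let $k\ge 1$ be an integer, let $D\subset\mathbb{R}^d$ be open and bounded, and let $M\subset D$ be a closed and bounded $d$-dimensional $C^{k+1}$-submanifold of $\mathbb{R}^d$ (with boundary). Let $J$ be a real-valued shape function, defined on a set $\Xi$ of closed and bounded $d$-dimensional $C^k$-submanifolds (with boundary) of $\mathbb{R}^d$ contained in $D$, with $M\in\Xi$. Suppose that $J$ is shape differentiable at $M$ and that $dJ(M)$ is of order $k$. Then there exists a continuous linear functional $g:C^k(\partial M)\to\mathbb{R}$ such that $$dJ(M)(X)=g(X|_{\partial M}\cdot\nu)\qquad\text{for all }X\in C^k_c(D,\mathbb{R}^d),$$ where $\nu$ is the outward-pointing unit normal field along $\partial M$.
   Context: Submanifolds: a $d$-dimensional $C^k$-submanifold $M$ of $\mathbb{R}^d$ with boundary is a subset such that for each $p\in M$ there are open sets $U\ni p$ and $V$ in $\mathbb{R}^d$ and a $C^k$-diffeomorphism $\varphi:U\to V$ with $\varphi(U\cap M)=V\cap\bar{\mathbb{H}}^d$, where $\bar{\mathbb{H}}^d=\mathbb{R}^{d-1}\times[0,\infty)$. The boundary $\partial M$ is the set of points mapped into $\mathbb{R}^{d-1}\times\{0\}$. Eulerian semi-derivative: for $X\in C^k_c(D,\mathbb{R}^d)$ ($C^k$ vector fields with compact support in $D$), $\Phi_t$ denotes the flow of $X$, $\frac{d}{dt}\Phi_t(x)=X(\Phi_t(x))$, $\Phi_0(x)=x$. For a function $J:\Xi\to\mathbb{R}$ on a set $\Xi$ of subsets of $D$ and $\Omega\in\Xi$ such that $\Phi_t(\Omega)\in\Xi$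 for all small $t>0$, $$dJ(\Omega)(X):=\lim_{t\searrow0}\frac{J(\Phi_t(\Omega))-J(\Omega)}{t}.$$ $J$ is shape differentiable at $\Omega$ if $dJ(\Omega)(X)$ exists for all $X\in C^\infty_c(D,\mathbb{R}^d)$ and $X\mapsto dJ(\Omega)(X)$ is linear and continuous there. The order of $dJ(\Omega)$ is the smallest integer $k\ge0$ for which $X\mapsto dJ(\Omega)(X)$ is continuous with respect to the $C^k_c(D,\mathbb{R}^d)$-topology, i.e. the topology given by the seminorms $\|f\|_{K,\alpha}=\sup_{x\in K}|\partial^\alpha f(x)|$, $K\subset D$ compact, $|\alpha|\le k$. Convention: when $dJ(\Omega)$ is said to be of order $k\ge1$, it is understood that the Eulerian semi-derivative $dJ(\Omega)(X)$ exists for all $X\in C^k_c(D,\mathbb{R}^d)$ and that $X\mapsto dJ(\Omega)(X)$ is linear and continuous on $C^k_c(D,\mathbb{R}^d)$. $C^k(\partial M)$ carries its usual $C^k$-norm topology. *)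

theory Defs
  imports "HOL-Analysis.Analysis"
begin

text \<open>The space \<open>\<real>\<^sup>d\<close> is an arbitrary type of class \<open>euclidean_space\<close>, with \<open>d = DIM('a)\<close>.
  Orders of differentiability range over \<open>enat\<close>, so that \<open>\<infinity>\<close> gives smooth maps.\<close>

section \<open>Maps of class \<open>C\<^sup>k\<close>\<close>

text \<open>A multi-index is encoded as the list of the coordinate directions of differentiation, so its
  order \<open>|\<alpha>|\<close> is the length of the list. The order of the entries is irrelevant for the
  functions at hand, by Schwarz's theorem.\<close>

primrec partial_deriv :: "'a list \<Rightarrow> ('a::euclidean_space \<Rightarrow> 'b::real_normed_vector) \<Rightarrow> 'a \<Rightarrow> 'b" where
  "partial_deriv [] f = f"
| "partial_deriv (b # \<alpha>) f = (\<lambda>x. frechet_derivative (partial_deriv \<alpha> f) (at x) b)"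

definition multi_indices :: "enat \<Rightarrow> 'a::euclidean_space list set" where
  "multi_indices k = {\<alpha> \<in> lists Basis. enat (length \<alpha>) \<le> k}"

text \<open>Meant for open \<open>S\<close> only: the derivatives are taken in the full space.\<close>

definition Ck_on :: "enat \<Rightarrow> 'a set \<Rightarrow> ('a::euclidean_space \<Rightarrow> 'b::real_normed_vector) \<Rightarrow> bool" where
  "Ck_on k S f \<longleftrightarrow>
     (\<forall>\<alpha> \<in> multi_indices k. continuous_on S (partial_deriv \<alpha> f)) \<and>
     (\<forall>\<alpha> \<in> multi_indices k. enat (length \<alpha>) < k \<longrightarrow>
        (\<forall>x\<in>S. partial_deriv \<alpha> f differentiable (at x)))"


section \<open>Function spaces with topologies given by seminorms\<close>

definition seminorm_topology ::
    "('x \<Rightarrow> 'y::real_normed_vector) set \<Rightarrow> (('x \<Rightarrow> 'y) \<Rightarrow> real) set \<Rightarrow> ('x \<Rightarrow> 'y) topology" where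
  "seminorm_topology V P = topology_generated_by
     (insert V {{f \<in> V. p (\<lambda>x. f x - f0 x) < \<epsilon>} | p f0 \<epsilon>. p \<in> P \<and> f0 \<in> V \<and> 0 < \<epsilon>})"

text \<open>Linearity of a functional on a space \<open>V\<close> of functions with domain \<open>S\<close>. Functions on a proper
  subset \<open>S\<close> are represented as elements of \<open>extensional S\<close>; for \<open>S = UNIV\<close> the restriction is
  the identity.\<close>

definition linear_functional_on ::
    "'x set \<Rightarrow> ('x \<Rightarrow> 'y::real_vector) set \<Rightarrow> (('x \<Rightarrow> 'y) \<Rightarrow> real) \<Rightarrow> bool" where
  "linear_functional_on S V L \<longleftrightarrow>
     (\<forall>f\<in>V. \<forall>g\<in>V. \<forall>a b. L (\<lambda>x\<in>S. a *\<^sub>R f x + b *\<^sub>R g x) = a * L f + b * L g)"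

text \<open>The value \<open>0\<close> is inserted only to make the supremum over \<open>K = {}\<close> equal to \<open>0\<close>.\<close>

definition sup_seminorm ::
    "'a set \<Rightarrow> 'a list \<Rightarrow> ('a::euclidean_space \<Rightarrow> 'b::real_normed_vector) \<Rightarrow> real" where
  "sup_seminorm K \<alpha> f = Sup (insert 0 ((\<lambda>x. norm (partial_deriv \<alpha> f x)) ` K))"

text \<open>The space \<open>C\<^sup>k\<^sub>c(D, \<real>\<^sup>d)\<close>; its elements are extended by zero to the whole space.\<close>

definition Ckc :: "enat \<Rightarrow> 'a set \<Rightarrow> ('a::euclidean_space \<Rightarrow> 'a) set" where
  "Ckc k D = {X. Ck_on k UNIV X \<and> compact (closure {x. X x \<noteq> 0}) \<and> closure {x. X x \<noteq> 0} \<subseteq> D}"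

definition Ckc_topology :: "enat \<Rightarrow> 'a set \<Rightarrow> ('a::euclidean_space \<Rightarrow> 'a) topology" where
  "Ckc_topology k D = seminorm_topology (Ckc k D)
     {sup_seminorm K \<alpha> | K \<alpha>. compact K \<and> K \<subseteq> D \<and> \<alpha> \<in> multi_indices k}"


section \<open>Submanifolds of full dimension, with boundary\<close>

text \<open>The half-space \<open>\<real>\<^bsup>d-1\<^esup> \<times> [0,\<infinity>)\<close> singles out one coordinate. The basis of a Euclidean space is
  not ordered, so one coordinate direction is fixed once and for all to play the role of the last.\<close>

definition last_axis :: "'a::euclidean_space" where
  "last_axis = (SOME b. b \<in> Basis)"

definition half_space :: "'a::euclidean_space set" where
  "half_space = {x. 0 \<le> x \<bullet> last_axis}"

definition half_space_bd :: "'a::euclidean_space set" where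
  "half_space_bd = {x. x \<bullet> last_axis = 0}"

text \<open>\<open>\<phi>\<close> is a \<open>C\<^sup>k\<close>-diffeomorphism from \<open>U\<close> onto \<open>V\<close> with inverse \<open>\<psi>\<close>, which flattens \<open>M\<close>.\<close>

definition submfd_chart ::
    "enat \<Rightarrow> 'a set \<Rightarrow> 'a set \<Rightarrow> 'a set \<Rightarrow> ('a::euclidean_space \<Rightarrow> 'a) \<Rightarrow> ('a \<Rightarrow> 'a) \<Rightarrow> bool" where
  "submfd_chart k M U V \<phi> \<psi> \<longleftrightarrow>
     open U \<and> open V \<and> homeomorphism U V \<phi> \<psi> \<and> Ck_on k U \<phi> \<and> Ck_on k V \<psi> \<and>
     \<phi> ` (U \<inter> M) = V \<inter> half_space"

definition submanifold :: "enat \<Rightarrow> 'a::euclidean_space set \<Rightarrow> bool" where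
  "submanifold k M \<longleftrightarrow> (\<forall>p\<in>M. \<exists>U V \<phi> \<psi>. p \<in> U \<and> submfd_chart k M U V \<phi> \<psi>)"

definition mfd_boundary :: "enat \<Rightarrow> 'a::euclidean_space set \<Rightarrow> 'a set" where
  "mfd_boundary k M =
     {p \<in> M. \<exists>U V \<phi> \<psi>. p \<in> U \<and> submfd_chart k M U V \<phi> \<psi> \<and> \<phi> p \<in> half_space_bd}"

text \<open>The tangent space of the boundary at \<open>p\<close> consists of the vectors mapped into \<open>\<real>\<^bsup>d-1\<^esup> \<times> {0}\<close> by the
  derivative of a chart. Since \<open>M\<close> corresponds to the upper half-space, outward-pointing vectors
  are those mapped to vectors with negative last coordinate.\<close>

definition is_outward_unit_normal :: "enat \<Rightarrow> 'a set \<Rightarrow> 'a \<Rightarrow> 'a::euclidean_space \<Rightarrow> bool" where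
  "is_outward_unit_normal k M p n \<longleftrightarrow> norm n = 1 \<and>
     (\<exists>U V \<phi> \<psi>. p \<in> U \<and> submfd_chart k M U V \<phi> \<psi> \<and> \<phi> p \<in> half_space_bd \<and>
        (\<forall>v. frechet_derivative \<phi> (at p) v \<in> half_space_bd \<longrightarrow> n \<bullet> v = 0) \<and>
        frechet_derivative \<phi> (at p) n \<bullet> last_axis < 0)"

definition outward_unit_normal :: "enat \<Rightarrow> 'a set \<Rightarrow> 'a \<Rightarrow> 'a::euclidean_space" where
  "outward_unit_normal k M p = (THE n. is_outward_unit_normal k M p n)"

text \<open>The space \<open>C\<^sup>k(\<partial>M)\<close> for \<open>M\<close> of class \<open>C\<^sup>m\<close>, \<open>m \<ge> k\<close>. A function on \<open>\<partial>M\<close> is read in a chart as a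
  function on an open subset of \<open>\<real>\<^bsup>d-1\<^esup> \<times> {0}\<close>, which is then extended to be constant in the last
  coordinate, so that it lives on an open subset of \<open>\<real>\<^sup>d\<close> and its derivatives are those along
  \<open>\<real>\<^bsup>d-1\<^esup> \<times> {0}\<close>.\<close>

definition flatten :: "'a::euclidean_space \<Rightarrow> 'a" where
  "flatten y = y - (y \<bullet> last_axis) *\<^sub>R last_axis"

definition Ck_boundary :: "enat \<Rightarrow> enat \<Rightarrow> 'a set \<Rightarrow> ('a::euclidean_space \<Rightarrow> real) set" where
  "Ck_boundary m k M = {f \<in> extensional (mfd_boundary m M).
     \<forall>U V \<phi> \<psi>. submfd_chart m M U V \<phi> \<psi> \<longrightarrow> Ck_on k (flatten -` V) (\<lambda>y. f (\<psi> (flatten y)))}"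

text \<open>The sup-seminorms of the derivatives over all compact pieces of charts. For compact \<open>\<partial>M\<close> and
  finite \<open>k\<close>, finitely many compact pieces cover \<open>\<partial>M\<close>, and the associated finitely many seminorms
  already generate the topology: their maximum is the usual \<open>C\<^sup>k\<close>-norm, which depends on the choice
  of the covering only up to equivalence.\<close>

definition Ck_boundary_topology ::
    "enat \<Rightarrow> enat \<Rightarrow> 'a set \<Rightarrow> ('a::euclidean_space \<Rightarrow> real) topology" where
  "Ck_boundary_topology m k M = seminorm_topology (Ck_boundary m k M)
     {(\<lambda>f. sup_seminorm K \<alpha> (\<lambda>y. f (\<psi> (flatten y)))) | K \<alpha> U V \<phi> \<psi>.
        submfd_chart m M U V \<phi> \<psi> \<and> compact K \<and> K \<subseteq> V \<inter> half_space_bd \<and> \<alpha> \<in> multi_indices k}"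


section \<open>Shape derivatives\<close>

text \<open>The integral curve through \<open>x\<close> is global and unique for \<open>X\<close> of class \<open>C\<^sup>1\<close> with compact support.\<close>

definition flow :: "('a::euclidean_space \<Rightarrow> 'a) \<Rightarrow> real \<Rightarrow> 'a \<Rightarrow> 'a" where
  "flow X t x =
     (THE c. c 0 = x \<and> (\<forall>s. (c has_vector_derivative X (c s)) (at s))) t"

definition difference_quotient ::
    "('a::euclidean_space set \<Rightarrow> real) \<Rightarrow> 'a set \<Rightarrow> ('a \<Rightarrow> 'a) \<Rightarrow> real \<Rightarrow> real" where
  "difference_quotient J \<Omega> X t = (J (flow X t ` \<Omega>) - J \<Omega>) / t"

text \<open>A shape function on \<open>\<Xi>\<close> is a total function \<open>J\<close> on sets of which only the values on \<open>\<Xi>\<close> matter,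
  since the flow is required to keep \<open>\<Omega>\<close> in \<open>\<Xi>\<close> for small times.\<close>

definition eulerian_semideriv_exists ::
    "'a set set \<Rightarrow> ('a::euclidean_space set \<Rightarrow> real) \<Rightarrow> 'a set \<Rightarrow> ('a \<Rightarrow> 'a) \<Rightarrow> bool" where
  "eulerian_semideriv_exists \<Xi> J \<Omega> X \<longleftrightarrow>
     \<Omega> \<in> \<Xi> \<and> (\<forall>\<^sub>F t in at_right 0. flow X t ` \<Omega> \<in> \<Xi>) \<and>
     (\<exists>l. (difference_quotient J \<Omega> X \<longlongrightarrow> l) (at_right 0))"

definition eulerian_semideriv ::
    "('a::euclidean_space set \<Rightarrow> real) \<Rightarrow> 'a set \<Rightarrow> ('a \<Rightarrow> 'a) \<Rightarrow> real" where
  "eulerian_semideriv J \<Omega> X = Lim (at_right 0) (difference_quotient J \<Omega> X)"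

definition differentiable_on_Ckc ::
    "enat \<Rightarrow> 'a set \<Rightarrow> 'a set set \<Rightarrow> ('a::euclidean_space set \<Rightarrow> real) \<Rightarrow> 'a set \<Rightarrow> bool" where
  "differentiable_on_Ckc k D \<Xi> J \<Omega> \<longleftrightarrow>
     (\<forall>X \<in> Ckc k D. eulerian_semideriv_exists \<Xi> J \<Omega> X) \<and>
     linear_functional_on UNIV (Ckc k D) (eulerian_semideriv J \<Omega>) \<and>
     continuous_map (Ckc_topology k D) euclideanreal (eulerian_semideriv J \<Omega>)"

definition shape_differentiable ::
    "'a set \<Rightarrow> 'a set set \<Rightarrow> ('a::euclidean_space set \<Rightarrow> real) \<Rightarrow> 'a set \<Rightarrow> bool" where
  "shape_differentiable D \<Xi> J \<Omega> \<longleftrightarrow> differentiable_on_Ckc \<infinity> D \<Xi> J \<Omega>"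

text \<open>Continuity of the shape derivative, as a functional on smooth fields, for the coarser
  \<open>C\<^sup>k\<close>-topology.\<close>

definition Ck_continuous_deriv ::
    "nat \<Rightarrow> 'a set \<Rightarrow> ('a::euclidean_space set \<Rightarrow> real) \<Rightarrow> 'a set \<Rightarrow> bool" where
  "Ck_continuous_deriv k D J \<Omega> \<longleftrightarrow>
     continuous_map (subtopology (Ckc_topology (enat k) D) (Ckc \<infinity> D)) euclideanreal
       (eulerian_semideriv J \<Omega>)"

text \<open>The last conjunct is the convention that a shape derivative of order \<open>k \<ge> 1\<close> is
  understood to exist on all of \<open>C\<^sup>k\<^sub>c(D, \<real>\<^sup>d)\<close> and to be linear and continuous there.\<close>

definition shape_deriv_of_order ::
    "nat \<Rightarrow> 'a set \<Rightarrow> 'a set set \<Rightarrow> ('a::euclidean_space set \<Rightarrow> real) \<Rightarrow> 'a set \<Rightarrow> bool" where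
  "shape_deriv_of_order k D \<Xi> J \<Omega> \<longleftrightarrow>
     Ck_continuous_deriv k D J \<Omega> \<and> (\<forall>j<k. \<not> Ck_continuous_deriv j D J \<Omega>) \<and>
     (1 \<le> k \<longrightarrow> differentiable_on_Ckc (enat k) D \<Xi> J \<Omega>)"

end

theory Submission
  imports Defs
begin

text \<open>If \<open>X\<close> is tangent to \<open>\<partial>M\<close>, its flow maps \<open>M\<close> onto itself, so all difference quotients of \<open>J\<close> along
  \<open>X\<close> vanish. Hence \<open>dJ(M)(X)\<close> depends on \<open>X \<cdot> \<nu>\<close> only. A continuous linear right inverse \<open>E\<close> of
  \<open>X \<mapsto> X \<cdot> \<nu>\<close> is glued together from charts: \<open>\<nu>\<close> is the normalised gradient of the last coordinate of a
  chart, so it extends to a field of class \<open>C\<^sup>k\<close> near \<open>\<partial>M\<close>, and this is where \<open>M\<close> has to be of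
  class \<open>C\<^bsup>k+1\<^esup>\<close>. Then \<open>g = dJ(M) \<circ> E\<close>.\<close>

section \<open>Calculus of maps of class \<open>C\<^sup>n\<close>\<close>

text \<open>An explicit right inverse lets \<open>g\<close> inherit linearity and continuity from
  \<open>dJ(M)\<close>. Choosing, for each \<open>f\<close>, some field with normal component
  \<open>f\<close> would define the same functional but give no direct access to its continuity. The
  values of \<open>E\<close> are only of class C^k, because the normal field is, so the shape
  derivative has to be available on all C^k fields. That k is at least 1 makes such fields
  Lipschitz. This yields a unique global flow, and also a bound \<bar>a'(X)\<bar> \<le> C
  \<bar>a\<bar> near the boundary for a local defining function a of it. Invariance of
  \<open>M\<close> rests on this bound: tangency is known on the boundary only, and curves that
  start there must not leave it. Cutoffs of class C^k are enough, so powers of positive parts of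
  quadratic polynomials serve as bumps.\<close>

lemma multi_indices_enat: "multi_indices (enat n) = {\<alpha> \<in> lists Basis. length \<alpha> \<le> n}"
  by (simp add: multi_indices_def)

lemma finite_multi_indices: "finite (multi_indices (enat n))"
  using finite_lists_length_le[OF finite_Basis, of n]
  by (rule rev_finite_subset) (auto simp: multi_indices_enat)

lemma multi_indices_Suc_cases:
  assumes "\<alpha> \<in> multi_indices (enat (Suc n))"
  obtains "\<alpha> = []" | b \<beta> where "\<alpha> = \<beta> @ [b]" "b \<in> Basis" "\<beta> \<in> multi_indices (enat n)"
  using assms by (cases \<alpha> rule: rev_cases) (auto simp: multi_indices_enat)

lemma multi_indices_snoc:
  "\<beta> \<in> multi_indices (enat n) \<Longrightarrow> b \<in> Basis \<Longrightarrow> \<beta> @ [b] \<in> multi_indices (enat (Suc n))"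
  by (auto simp: multi_indices_enat)

lemma Nil_in_multi_indices [simp]: "[] \<in> multi_indices (enat n)"
  by (simp add: multi_indices_enat)

lemma multi_indices_mono: "n \<le> m \<Longrightarrow> multi_indices (enat n) \<subseteq> multi_indices (enat m)"
  by (auto simp: multi_indices_enat)

text \<open>The recursion of \<open>partial_deriv\<close> strips the derivative taken last.
  Inductions on the order of differentiability pass from \<open>f\<close> to its first partial
  derivatives, so they strip the derivative taken first, at the end of the list.\<close>

lemma partial_deriv_snoc: "partial_deriv (\<alpha> @ [b]) f = partial_deriv \<alpha> (partial_deriv [b] f)"
  by (induction \<alpha>) simp_all

lemma frechet_derivative_cong_open:
  assumes "open S" "\<And>x. x \<in> S \<Longrightarrow> f x = g x" "x \<in> S"
  shows "frechet_derivative f (at x) = frechet_derivative g (at x)"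
proof -
  have "(f has_derivative D) (at x) \<longleftrightarrow> (g has_derivative D) (at x)" for D
    using assms by (metis has_derivative_transform_within_open)
  then show ?thesis
    by (simp add: frechet_derivative_def)
qed

lemma partial_deriv_cong_open:
  assumes "open S" "\<And>x. x \<in> S \<Longrightarrow> f x = g x" "x \<in> S"
  shows "partial_deriv \<alpha> f x = partial_deriv \<alpha> g x"
  using assms(3)
proof (induction \<alpha> arbitrary: x)
  case (Cons b \<alpha>)
  then show ?case
    using frechet_derivative_cong_open[OF assms(1), of "partial_deriv \<alpha> f" "partial_deriv \<alpha> g" x]
    by simp
qed (simp add: assms)

section \<open>Recursive description and closure properties of C^n maps\<close>

lemma Ck_on_0: "Ck_on (enat 0) S f \<longleftrightarrow> continuous_on S f"
  unfolding Ck_on_def multi_indices_enat by auto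

text \<open>Splitting off the derivative taken first turns the definition by multi-indices into a
  recursion on the order. The closure properties under algebraic operations and composition rest on
  inductions along it.\<close>

lemma Ck_on_Suc:
  fixes f :: "'a::euclidean_space \<Rightarrow> 'b::real_normed_vector"
  shows
  "Ck_on (enat (Suc n)) S f \<longleftrightarrow>
     (\<forall>x\<in>S. f differentiable (at x)) \<and> (\<forall>b\<in>Basis. Ck_on (enat n) S (partial_deriv [b] f))"
  (is "?L \<longleftrightarrow> ?R")
proof
  assume L: ?L
  have "f differentiable (at x)" if "x \<in> S" for x
    using L that Nil_in_multi_indices[of "Suc n"] unfolding Ck_on_def
    by (metis enat_ord_simps(2) list.size(3) partial_deriv.simps(1) zero_less_Suc)
  moreover have "Ck_on (enat n) S (partial_deriv [b] f)" if "b \<in> Basis" for b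
    unfolding Ck_on_def
  proof (intro conjI ballI impI)
    fix \<alpha> :: "'a list" assume "\<alpha> \<in> multi_indices (enat n)"
    then have "\<alpha> @ [b] \<in> multi_indices (enat (Suc n))"
      using that by (rule multi_indices_snoc)
    then show "continuous_on S (partial_deriv \<alpha> (partial_deriv [b] f))"
      using L unfolding Ck_on_def partial_deriv_snoc[symmetric] by blast
  next
    fix \<alpha> :: "'a list" and x assume \<alpha>: "\<alpha> \<in> multi_indices (enat n)" "enat (length \<alpha>) < enat n" "x \<in> S"
    then have "\<alpha> @ [b] \<in> multi_indices (enat (Suc n))" "enat (length (\<alpha> @ [b])) < enat (Suc n)"
      using that by (auto intro: multi_indices_snoc)
    then show "partial_deriv \<alpha> (partial_deriv [b] f) differentiable at x"
      using L \<alpha> unfolding Ck_on_def partial_deriv_snoc[symmetric] by blast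
  qed
  ultimately show ?R by blast
next
  assume R: ?R
  show ?L
    unfolding Ck_on_def
  proof (intro conjI ballI impI)
    fix \<alpha> :: "'a list" assume "\<alpha> \<in> multi_indices (enat (Suc n))"
    then show "continuous_on S (partial_deriv \<alpha> f)"
    proof (cases rule: multi_indices_Suc_cases)
      case 1
      then show ?thesis
        using R by (auto intro!: continuous_at_imp_continuous_on differentiable_imp_continuous_within)
    next
      case (2 b \<beta>)
      then show ?thesis
        using R unfolding \<open>\<alpha> = _\<close> partial_deriv_snoc Ck_on_def by blast
    qed
  next
    fix \<alpha> :: "'a list" and x assume "\<alpha> \<in> multi_indices (enat (Suc n))" and l: "enat (length \<alpha>) < enat (Suc n)" "x \<in> S"
    then show "partial_deriv \<alpha> f differentiable at x"
    proof (cases rule: multi_indices_Suc_cases)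
      case 1
      then show ?thesis using R l by auto
    next
      case (2 b \<beta>)
      then have "enat (length \<beta>) < enat n" using l by simp
      then show ?thesis
        using R 2 l unfolding \<open>\<alpha> = _\<close> partial_deriv_snoc Ck_on_def by blast
    qed
  qed
qed

lemma Ck_on_continuous: "Ck_on (enat n) S f \<Longrightarrow> continuous_on S f"
  by (force simp: Ck_on_def dest!: bspec[where x="[]"])

lemma Ck_on_partial_continuous:
  "Ck_on (enat n) S f \<Longrightarrow> \<alpha> \<in> multi_indices (enat n) \<Longrightarrow> continuous_on S (partial_deriv \<alpha> f)"
  by (simp add: Ck_on_def)

lemma Ck_on_has_derivative:
  "Ck_on (enat (Suc n)) S f \<Longrightarrow> x \<in> S \<Longrightarrow> (f has_derivative frechet_derivative f (at x)) (at x)"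
  by (simp add: Ck_on_Suc frechet_derivative_works)

lemma Ck_on_frechet:
  "Ck_on (enat (Suc n)) S f \<Longrightarrow> b \<in> Basis \<Longrightarrow> Ck_on (enat n) S (\<lambda>x. frechet_derivative f (at x) b)"
  by (simp add: Ck_on_Suc)

lemma Ck_on_cong_open:
  assumes "open S" "\<And>x. x \<in> S \<Longrightarrow> f x = g x" "Ck_on (enat n) S f"
  shows "Ck_on (enat n) S g"
  using assms(2,3)
proof (induction n arbitrary: f g)
  case 0
  then show ?case by (simp add: Ck_on_0 cong: continuous_on_cong)
next
  case (Suc n)
  have "g differentiable at x" if "x \<in> S" for x
    using Suc.prems that assms(1) has_derivative_transform_within_open[of f _ x UNIV S g]
    unfolding Ck_on_Suc differentiable_def by blast
  moreover have "Ck_on (enat n) S (partial_deriv [b] g)" if "b \<in> Basis" for b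
    by (rule Suc.IH[of "partial_deriv [b] f"])
      (use Suc.prems that partial_deriv_cong_open[OF assms(1), of f g _ "[b]"] in \<open>auto simp: Ck_on_Suc\<close>)
  ultimately show ?case by (simp add: Ck_on_Suc)
qed

text \<open>Lets an induction work with the derivative in the form delivered by the product or chain
  rule. On an open set this form may replace the chosen \<open>frechet_derivative\<close>, since
  derivatives there are unique and regularity is local.\<close>

lemma Ck_on_SucI:
  assumes "open S" "\<And>x. x \<in> S \<Longrightarrow> (f has_derivative f' x) (at x)"
    "\<And>b. b \<in> Basis \<Longrightarrow> Ck_on (enat n) S (\<lambda>x. f' x b)"
  shows "Ck_on (enat (Suc n)) S f"
  unfolding Ck_on_Suc
proof (intro conjI ballI)
  show "f differentiable at x" if "x \<in> S" for x
    using assms(2)[OF that] by (auto simp: differentiable_def)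
  show "Ck_on (enat n) S (partial_deriv [b] f)" if "b \<in> Basis" for b
    by (rule Ck_on_cong_open[OF assms(1) _ assms(3)[OF that]])
      (use assms(2) frechet_derivative_at in fastforce)
qed

lemma Ck_on_subset: "Ck_on n S f \<Longrightarrow> T \<subseteq> S \<Longrightarrow> Ck_on n T f"
  unfolding Ck_on_def by (meson continuous_on_subset subsetD)

lemma Ck_on_mono: "Ck_on (enat n) S f \<Longrightarrow> m \<le> n \<Longrightarrow> Ck_on (enat m) S f"
  using multi_indices_mono[of m n] unfolding Ck_on_def by fastforce

lemma Ck_on_Un_open:
  assumes "open S" "open T" "Ck_on n S f" "Ck_on n T f"
  shows "Ck_on n (S \<union> T) f"
  using assms unfolding Ck_on_def by (auto intro: continuous_on_open_Un)

lemma Ck_on_const: "Ck_on (enat n) S (\<lambda>x. c)"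
proof -
  \<comment> \<open>\<open>Ck_on_SucI\<close> asks for an open set while \<open>S\<close> is
    arbitrary, so the induction runs on the whole space and the result is restricted.\<close>
  have "Ck_on (enat n) UNIV (\<lambda>x::'a. c)" for c :: 'b
  proof (induction n arbitrary: c)
    case (Suc n)
    show ?case by (rule Ck_on_SucI[where f'="\<lambda>x h. 0"]) (auto intro: Suc)
  qed (simp add: Ck_on_0)
  then show ?thesis by (rule Ck_on_subset) simp
qed

lemma Ck_on_bounded_linear:
  assumes "bounded_linear L" shows "Ck_on (enat n) S L"
proof (cases n)
  case (Suc m)
  have "Ck_on (enat n) UNIV L"
    unfolding Suc
    by (rule Ck_on_SucI[where f'="\<lambda>x. L"])
      (auto intro: Ck_on_const bounded_linear_imp_has_derivative assms)
  then show ?thesis by (rule Ck_on_subset) simp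
qed (simp add: Ck_on_0 assms linear_continuous_on)

lemma Ck_on_add:
  assumes "open S" "Ck_on (enat n) S f" "Ck_on (enat n) S g"
  shows "Ck_on (enat n) S (\<lambda>x. f x + g x)"
  using assms(2,3)
proof (induction n arbitrary: f g)
  case 0
  then show ?case by (auto simp: Ck_on_0 intro: continuous_intros)
next
  case (Suc n)
  show ?case
    by (rule Ck_on_SucI[OF assms(1) has_derivative_add[OF Suc.prems[THEN Ck_on_has_derivative]]])
      (use Suc in \<open>auto intro!: Suc.IH Ck_on_frechet\<close>)
qed

lemma Ck_on_sum:
  assumes "open S" "\<And>i. i \<in> I \<Longrightarrow> Ck_on (enat n) S (f i)"
  shows "Ck_on (enat n) S (\<lambda>x. \<Sum>i\<in>I. f i x)"
  using assms(2) by (induction I rule: infinite_finite_induct) (auto intro: Ck_on_const Ck_on_add assms(1))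

lemma Ck_on_scaleR:
  fixes f :: "'a::euclidean_space \<Rightarrow> real"
  assumes "open S" "Ck_on (enat n) S f" "Ck_on (enat n) S g"
  shows "Ck_on (enat n) S (\<lambda>x. f x *\<^sub>R g x)"
  using assms(2,3)
proof (induction n arbitrary: f g)
  case 0
  then show ?case by (auto simp: Ck_on_0 intro: continuous_intros)
next
  case (Suc n)
  have "Ck_on (enat n) S f" "Ck_on (enat n) S g"
    using Suc.prems by (auto intro: Ck_on_mono)
  then show ?case
    by (intro Ck_on_SucI[OF assms(1) has_derivative_scaleR[OF Suc.prems[THEN Ck_on_has_derivative]]])
      (use Suc in \<open>auto intro!: Suc.IH Ck_on_frechet Ck_on_add assms(1)\<close>)
qed

lemma Ck_on_mult:
  fixes f :: "'a::euclidean_space \<Rightarrow> real"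
  assumes "open S" "Ck_on (enat n) S f" "Ck_on (enat n) S g"
  shows "Ck_on (enat n) S (\<lambda>x. f x * g x)"
  using Ck_on_scaleR[OF assms] by simp

lemma Ck_on_linear_compose:
  assumes "open S" "bounded_linear L" "Ck_on (enat n) S f"
  shows "Ck_on (enat n) S (\<lambda>x. L (f x))"
  using assms(3)
proof (induction n arbitrary: f)
  case 0
  then show ?case by (auto simp: Ck_on_0 intro: bounded_linear.continuous_on[OF assms(2)])
next
  case (Suc n)
  show ?case
    by (rule Ck_on_SucI[OF assms(1) bounded_linear.has_derivative[OF assms(2)
            Ck_on_has_derivative[OF Suc.prems]]])
      (use Suc in \<open>auto intro!: Suc.IH Ck_on_frechet\<close>)
qed

text \<open>By the chain rule a partial derivative of the composition is a sum of products of
  components of the derivative of \<open>g\<close> with partial derivatives of \<open>f\<close>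
  composed with the same \<open>g\<close>. Hence the induction varies \<open>f\<close> and keeps
  \<open>g\<close> fixed.\<close>

lemma Ck_on_compose:
  fixes g :: "'a::euclidean_space \<Rightarrow> 'b::euclidean_space" and f :: "'b \<Rightarrow> 'c::real_normed_vector"
  assumes "open S" "open T" "\<And>x. x \<in> S \<Longrightarrow> g x \<in> T" "Ck_on (enat n) T f" "Ck_on (enat n) S g"
  shows "Ck_on (enat n) S (\<lambda>x. f (g x))"
  using assms(4,5)
proof (induction n arbitrary: f)
  case 0
  then show ?case
    using assms(3) by (auto simp: Ck_on_0 intro!: continuous_on_compose2[of T f S g])
next
  case (Suc n)
  have g: "Ck_on (enat n) S g"
    using Suc.prems by (auto intro: Ck_on_mono)
  have in_comp: "Ck_on (enat n) S (\<lambda>x. frechet_derivative g (at x) b \<bullet> e)" if "b \<in> Basis" for b e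
    by (rule Ck_on_linear_compose[OF assms(1) bounded_linear_inner_left Ck_on_frechet[OF Suc.prems(2) that]])
  show ?case
  proof (rule Ck_on_SucI[OF assms(1)])
    fix x assume x: "x \<in> S"
    let ?D = "frechet_derivative f (at (g x))" and ?d = "frechet_derivative g (at x)"
    have D: "(f has_derivative ?D) (at (g x))"
      by (rule Ck_on_has_derivative[OF Suc.prems(1) assms(3)[OF x]])
    have "((\<lambda>x. f (g x)) has_derivative (\<lambda>h. ?D (?d h))) (at x)"
      using diff_chain_at[OF Ck_on_has_derivative[OF Suc.prems(2) x] D] by (simp add: o_def)
    \<comment> \<open>The direction \<open>?d h\<close> moves with the point. Expanding it in the
      basis leaves derivatives of \<open>f\<close> in fixed directions, to which the induction
      hypothesis applies.\<close>
    moreover have "?D (?d h) = (\<Sum>e\<in>Basis. (?d h \<bullet> e) *\<^sub>R ?D e)" for h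
      using linear_sum[OF has_derivative_linear[OF D], of "\<lambda>e. (?d h \<bullet> e) *\<^sub>R e" Basis]
      by (simp add: euclidean_representation linear_scale[OF has_derivative_linear[OF D]])
    ultimately show "((\<lambda>x. f (g x)) has_derivative
        (\<lambda>h. \<Sum>e\<in>Basis. (?d h \<bullet> e) *\<^sub>R ?D e)) (at x)" by simp
  next
    fix b :: 'a assume "b \<in> Basis"
    then show "Ck_on (enat n) S (\<lambda>x. \<Sum>e\<in>Basis. (frechet_derivative g (at x) b \<bullet> e) *\<^sub>R
        frechet_derivative f (at (g x)) e)"
      using g Suc.prems by (intro Ck_on_sum Ck_on_scaleR in_comp assms(1) Suc.IH Ck_on_frechet)
  qed
qed

lemma multi_indices_0: "multi_indices 0 = {[]}"
  unfolding zero_enat_def multi_indices_enat by auto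

lemma Ck_on_diff:
  assumes "open S" "Ck_on (enat n) S f" "Ck_on (enat n) S g"
  shows "Ck_on (enat n) S (\<lambda>x. f x - g x)"
  using Ck_on_add[OF assms(1,2) Ck_on_linear_compose[OF assms(1) bounded_linear_minus[OF bounded_linear_ident] assms(3)]]
  by simp

lemma Ck_on_inner:
  fixes f g :: "'a::euclidean_space \<Rightarrow> 'b::euclidean_space"
  assumes "open S" "Ck_on (enat n) S f" "Ck_on (enat n) S g"
  shows "Ck_on (enat n) S (\<lambda>x. f x \<bullet> g x)"
proof -
  have "(\<lambda>x. f x \<bullet> g x) = (\<lambda>x. \<Sum>b\<in>Basis. (f x \<bullet> b) * (g x \<bullet> b))"
    by (rule ext) (rule euclidean_inner)
  then show ?thesis
    by (simp only:) (intro Ck_on_sum Ck_on_mult Ck_on_linear_compose[OF _ bounded_linear_inner_left] assms)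
qed

text \<open>The derivative of 1/\<bar>w\<bar> is a polynomial in 1/\<bar>w\<bar>, \<open>w\<close>
  and the derivative of \<open>w\<close>, so the induction closes without treating norm and inverse
  separately.\<close>

lemma Ck_on_inverse_norm:
  fixes w :: "'a::euclidean_space \<Rightarrow> 'b::euclidean_space"
  assumes "open S" "\<And>x. x \<in> S \<Longrightarrow> w x \<noteq> 0" "Ck_on (enat n) S w"
  shows "Ck_on (enat n) S (\<lambda>x. inverse (norm (w x)))"
  using assms(3)
proof (induction n)
  case 0
  then show ?case
    using assms(2) by (auto simp: Ck_on_0 intro!: continuous_intros)
next
  case (Suc n)
  have w: "Ck_on (enat n) S w"
    using Suc.prems by (auto intro: Ck_on_mono)
  let ?i = "\<lambda>x. inverse (norm (w x))" and ?d = "\<lambda>x. frechet_derivative w (at x)"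
  show ?case
  proof (rule Ck_on_SucI[OF assms(1)])
    fix x assume x: "x \<in> S"
    have "((\<lambda>x. norm (w x)) has_derivative (\<lambda>h. ?d x h \<bullet> sgn (w x))) (at x)"
      using diff_chain_at[OF Ck_on_has_derivative[OF Suc.prems x]
          has_derivative_norm[OF assms(2)[OF x]]]
      by (simp add: o_def)
    from Deriv.has_derivative_inverse[OF _ this] assms(2)[OF x]
    show "(?i has_derivative (\<lambda>h. (- 1) * ((?i x * ?i x) * (?i x * (?d x h \<bullet> w x))))) (at x)"
      by (simp add: sgn_div_norm mult_ac)
  next
    fix b :: 'a assume b: "b \<in> Basis"
    show "Ck_on (enat n) S (\<lambda>x. (- 1) * ((?i x * ?i x) * (?i x * (?d x b \<bullet> w x))))"
      by (intro Ck_on_mult Ck_on_const Ck_on_inner Ck_on_frechet Suc.IH w assms(1) Suc.prems b)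
  qed
qed

section \<open>Finitely differentiable cutoffs from positive parts\<close>

text \<open>At 0 the difference quotient is the positive part to the next lower power, which tends
  to 0; elsewhere the function agrees locally with a power or with 0. The exponent is at least 2
  because the positive part itself has a corner at 0.\<close>

lemma has_real_derivative_pos_part_power:
  "((\<lambda>u::real. max 0 u ^ Suc (Suc j)) has_real_derivative (real (Suc (Suc j)) * max 0 u ^ Suc j)) (at u)"
proof -
  consider "u > 0" | "u < 0" | "u = 0" by linarith
  then show ?thesis
  proof cases
    case 1
    have "((\<lambda>u::real. u ^ Suc (Suc j)) has_real_derivative (real (Suc (Suc j)) * u ^ Suc j)) (at u)"
      using DERIV_pow[of "Suc (Suc j)" u] by simp
    from has_field_derivative_transform_within_open[OF this, of "{0<..}"] 1 show ?thesis
      by (simp add: max_def del: power_Suc)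
  next
    case 2
    have "((\<lambda>u::real. 0) has_real_derivative 0) (at u)" by simp
    from has_field_derivative_transform_within_open[OF this, of "{..<0}"] 2 show ?thesis
      by (simp add: max_def)
  next
    case 3
    have "((\<lambda>h. max 0 h ^ Suc j) \<longlongrightarrow> max 0 0 ^ Suc j) (at (0::real))"
      by (intro tendsto_intros)
    moreover have "(max 0 h ^ Suc (Suc j) - max 0 0 ^ Suc (Suc j)) / h = max 0 h ^ Suc j" for h :: real
      by (cases "h > 0") (auto simp: max_def)
    ultimately show ?thesis
      unfolding 3 has_field_derivative_iff by (simp del: power_Suc) 
  qed
qed

text \<open>Each derivative lowers the exponent by one and multiplies by a derivative of
  \<open>g\<close>. Starting from \<open>j + 1\<close>, the exponent is still positive after
  \<open>n \<le> j\<close> steps, so the function is still continuous.\<close>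

lemma Ck_on_pos_part_power:
  fixes g :: "'a::euclidean_space \<Rightarrow> real"
  assumes "open S" "Ck_on (enat n) S g" "n \<le> j"
  shows "Ck_on (enat n) S (\<lambda>x. max 0 (g x) ^ Suc j)"
  using assms(2,3)
proof (induction n arbitrary: j)
  case 0
  then show ?case
    unfolding Ck_on_0 by (intro continuous_intros)
next
  case (Suc n)
  obtain i where i: "j = Suc i" "n \<le> i"
    using Suc.prems by (cases j) auto
  have g: "Ck_on (enat n) S g"
    using Suc.prems by (auto intro: Ck_on_mono)
  show ?case
  proof (rule Ck_on_SucI[OF assms(1)])
    fix x assume x: "x \<in> S"
    show "((\<lambda>x. max 0 (g x) ^ Suc j) has_derivative (\<lambda>h. (real (Suc (Suc i)) * max 0 (g x) ^ Suc i) * frechet_derivative g (at x) h)) (at x)"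
      using diff_chain_at[OF Ck_on_has_derivative[OF Suc.prems(1) x]
          has_field_derivative_imp_has_derivative[OF has_real_derivative_pos_part_power[of i]]]
      by (simp add: o_def i(1) del: power_Suc)
  next
    fix b :: 'a assume "b \<in> Basis"
    then show "Ck_on (enat n) S (\<lambda>x. (real (Suc (Suc i)) * max 0 (g x) ^ Suc i) * frechet_derivative g (at x) b)"
      using Suc.prems by (intro Ck_on_mult Ck_on_const Suc.IH Ck_on_frechet i(2) g assms(1))
  qed
qed

section \<open>Iterated partial derivatives of sums and compositions\<close>

lemma partial_deriv_add:
  assumes "open S" "Ck_on (enat n) S f" "Ck_on (enat n) S g" "\<alpha> \<in> multi_indices (enat n)" "x \<in> S"
  shows "partial_deriv \<alpha> (\<lambda>x. f x + g x) x = partial_deriv \<alpha> f x + partial_deriv \<alpha> g x"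
  using assms(2-5)
proof (induction n arbitrary: \<alpha> f g x)
  case 0
  then show ?case by (auto simp: multi_indices_0 simp flip: zero_enat_def)
next
  case (Suc n)
  from Suc.prems(3) show ?case
  proof (cases rule: multi_indices_Suc_cases)
    case (2 b \<beta>)
    have "partial_deriv [b] (\<lambda>x. f x + g x) y = partial_deriv [b] f y + partial_deriv [b] g y"
      if "y \<in> S" for y
      using frechet_derivative_at[OF has_derivative_add[OF Suc.prems(1,2)[THEN Ck_on_has_derivative[OF _ that]]]]
      by (simp add: fun_eq_iff)
    then have "partial_deriv \<beta> (partial_deriv [b] (\<lambda>x. f x + g x)) x
        = partial_deriv \<beta> (\<lambda>y. partial_deriv [b] f y + partial_deriv [b] g y) x"
      by (rule partial_deriv_cong_open[OF assms(1) _ Suc.prems(4)])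
    also have "\<dots> = partial_deriv \<beta> (partial_deriv [b] f) x + partial_deriv \<beta> (partial_deriv [b] g) x"
      using Suc.prems(1,2) 2 by (intro Suc.IH Suc.prems(4)) (auto simp: Ck_on_Suc simp del: partial_deriv.simps)
    finally show ?thesis
      unfolding 2 partial_deriv_snoc .
  qed simp
qed

lemma partial_deriv_zero: "partial_deriv \<alpha> (\<lambda>x::'a::euclidean_space. 0::'b::real_normed_vector) x = 0"
proof (induction \<alpha> arbitrary: x)
  case (Cons b \<alpha>)
  then have "partial_deriv \<alpha> (\<lambda>x::'a. 0::'b) = (\<lambda>x. 0)" by auto
  then show ?case by simp
qed simp

lemma partial_deriv_sum:
  assumes "open S" "\<And>i. i \<in> I \<Longrightarrow> Ck_on (enat n) S (f i)" "\<alpha> \<in> multi_indices (enat n)" "x \<in> S"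
  shows "partial_deriv \<alpha> (\<lambda>x. \<Sum>i\<in>I. f i x) x = (\<Sum>i\<in>I. partial_deriv \<alpha> (f i) x)"
  using assms(2)
proof (induction I rule: infinite_finite_induct)
  case (insert i I)
  then show ?case
    using partial_deriv_add[OF assms(1) _ Ck_on_sum assms(3,4), of "f i" I f] assms(1) by simp
qed (simp_all add: partial_deriv_zero)

text \<open>By the product and the chain rule, the derivatives of \<open>h \<circ> \<Phi>\<close> times a fixed coefficient are
  linear combinations of the derivatives of \<open>h\<close> along \<open>\<Phi>\<close>, with coefficients independent of \<open>h\<close>.\<close>

lemma partial_deriv_compose_bound:
  fixes \<Phi> :: "'a::euclidean_space \<Rightarrow> 'b::euclidean_space" and c :: "'a \<Rightarrow> 'c::real_normed_vector"
  assumes "open S" "open T" "\<And>x. x \<in> S \<Longrightarrow> \<Phi> x \<in> T" "compact K" "K \<subseteq> S"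
    and "Ck_on (enat n) S \<Phi>" "Ck_on (enat n) S c" "\<alpha> \<in> multi_indices (enat n)"
  shows "\<exists>C\<ge>0. \<forall>h::'b \<Rightarrow> real. \<forall>x\<in>K. \<forall>B. Ck_on (enat n) T h \<longrightarrow>
    (\<forall>\<beta>\<in>multi_indices (enat n). \<bar>partial_deriv \<beta> h (\<Phi> x)\<bar> \<le> B) \<longrightarrow>
    norm (partial_deriv \<alpha> (\<lambda>x. h (\<Phi> x) *\<^sub>R c x) x) \<le> C * B"
  using assms(6-8)
proof (induction n arbitrary: c \<alpha>)
  case (0 c \<alpha>)
  have "\<alpha> = []" using 0 by (auto simp: multi_indices_0 simp flip: zero_enat_def)
  have "compact (c ` K)"
    using 0 assms(4,5) by (auto simp: Ck_on_0 intro: compact_continuous_image continuous_on_subset)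
  then obtain C where C: "\<And>x. x \<in> K \<Longrightarrow> norm (c x) \<le> C"
    by (meson bounded_iff compact_imp_bounded imageI)
  show ?case
  proof (intro exI[of _ "\<bar>C\<bar>"] conjI allI ballI impI)
    fix h :: "'b \<Rightarrow> real" and x B
    assume "x \<in> K" and B: "\<forall>\<beta>\<in>multi_indices (enat 0). \<bar>partial_deriv \<beta> h (\<Phi> x)\<bar> \<le> B"
    have "\<bar>h (\<Phi> x)\<bar> \<le> B" using B[rule_format, OF Nil_in_multi_indices] by simp
    then have "\<bar>h (\<Phi> x)\<bar> * norm (c x) \<le> B * \<bar>C\<bar>"
      using C[OF \<open>x \<in> K\<close>] by (intro mult_mono) auto
    then show "norm (partial_deriv \<alpha> (\<lambda>x. h (\<Phi> x) *\<^sub>R c x) x) \<le> \<bar>C\<bar> * B"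
      by (simp add: \<open>\<alpha> = []\<close> mult.commute)
  qed simp
next
  case (Suc n c \<alpha>)
  have \<Phi>: "Ck_on (enat n) S \<Phi>" and c: "Ck_on (enat n) S c"
    using Suc.prems by (auto intro: Ck_on_mono)
  show ?case
    using Suc.prems(3)
  proof (cases rule: multi_indices_Suc_cases)
    case 1
    from Suc.IH[OF \<Phi> c, of "[]"] obtain C where "C \<ge> 0" and
      C: "\<And>h x B. x \<in> K \<Longrightarrow> Ck_on (enat n) T h \<Longrightarrow>
        (\<forall>\<beta>\<in>multi_indices (enat n). \<bar>partial_deriv \<beta> h (\<Phi> x)\<bar> \<le> B) \<Longrightarrow>
        norm (h (\<Phi> x) *\<^sub>R c x) \<le> C * B"
      by auto
    show ?thesis
      unfolding 1 partial_deriv.simps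
      by (intro exI[of _ C] conjI \<open>C \<ge> 0\<close> allI ballI impI C)
        (use multi_indices_mono[of n "Suc n"] in \<open>auto intro: Ck_on_mono\<close>)
  next
    case (2 b \<beta>)
    \<comment> \<open>One derivative in direction \<open>b\<close> falls either on the coefficient,
      giving \<open>?dc\<close>, or on \<open>h\<close>, giving components of the derivative of
      \<open>\<Phi>\<close> times \<open>c\<close>. These are the new coefficients for the induction
      hypothesis; they are fixed before \<open>h\<close>, so the constants do not depend on
      \<open>h\<close>.\<close>
    let ?dc = "\<lambda>x. frechet_derivative c (at x) b"
    let ?d\<Phi> = "\<lambda>e x. (frechet_derivative \<Phi> (at x) b \<bullet> e) *\<^sub>R c x"
    have dc: "Ck_on (enat n) S ?dc"
      using Suc.prems 2 by (intro Ck_on_frechet)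
    have d\<Phi>: "Ck_on (enat n) S (?d\<Phi> e)" for e
      using Suc.prems 2 c
      by (intro Ck_on_scaleR Ck_on_linear_compose[OF _ bounded_linear_inner_left] Ck_on_frechet assms(1))
    obtain C0 where C0: "C0 \<ge> 0" "\<And>h x B. x \<in> K \<Longrightarrow> Ck_on (enat n) T h \<Longrightarrow>
        (\<forall>\<beta>\<in>multi_indices (enat n). \<bar>partial_deriv \<beta> h (\<Phi> x)\<bar> \<le> B) \<Longrightarrow>
        norm (partial_deriv \<beta> (\<lambda>x. h (\<Phi> x) *\<^sub>R ?dc x) x) \<le> C0 * B"
      using Suc.IH[OF \<Phi> dc 2(3)] by blast
    let ?P = "\<lambda>e C. C \<ge> 0 \<and> (\<forall>h::'b \<Rightarrow> real. \<forall>x\<in>K. \<forall>B. Ck_on (enat n) T h \<longrightarrow>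
        (\<forall>\<beta>\<in>multi_indices (enat n). \<bar>partial_deriv \<beta> h (\<Phi> x)\<bar> \<le> B) \<longrightarrow>
        norm (partial_deriv \<beta> (\<lambda>x. h (\<Phi> x) *\<^sub>R ?d\<Phi> e x) x) \<le> C * B)"
    have "\<forall>e. \<exists>C. ?P e C"
      by (intro allI Suc.IH[OF \<Phi> d\<Phi> 2(3)])
    from choice[OF this] obtain C where CP: "\<forall>e. ?P e (C e)" ..
    have C: "C e \<ge> 0" "\<And>h x B. x \<in> K \<Longrightarrow> Ck_on (enat n) T h \<Longrightarrow>
        (\<forall>\<beta>\<in>multi_indices (enat n). \<bar>partial_deriv \<beta> h (\<Phi> x)\<bar> \<le> B) \<Longrightarrow>
        norm (partial_deriv \<beta> (\<lambda>x. h (\<Phi> x) *\<^sub>R ?d\<Phi> e x) x) \<le> C e * B" for e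
      using CP[rule_format, of e] by simp_all
    show ?thesis
    proof (intro exI[of _ "C0 + (\<Sum>e\<in>Basis. C e)"] conjI allI ballI impI)
      show "0 \<le> C0 + (\<Sum>e\<in>Basis. C e)"
        by (intro add_nonneg_nonneg sum_nonneg C0 C)
      fix h :: "'b \<Rightarrow> real" and x B
      assume x: "x \<in> K" and h: "Ck_on (enat (Suc n)) T h"
        and B: "\<forall>\<beta>\<in>multi_indices (enat (Suc n)). \<bar>partial_deriv \<beta> h (\<Phi> x)\<bar> \<le> B"
      have xS: "x \<in> S" using x assms(5) by blast
      have hn: "Ck_on (enat n) T h" using h by (auto intro: Ck_on_mono)
      let ?dh = "\<lambda>e y. frechet_derivative h (at y) e"
      have dh: "Ck_on (enat n) T (?dh e)" if "e \<in> Basis" for e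
        using that h by (intro Ck_on_frechet)
      have h\<Phi>: "Ck_on (enat n) S (\<lambda>x. h (\<Phi> x))"
        by (rule Ck_on_compose[OF assms(1,2,3) hn \<Phi>])
      have dh\<Phi>: "Ck_on (enat n) S (\<lambda>x. ?dh e (\<Phi> x))" if "e \<in> Basis" for e
        by (rule Ck_on_compose[OF assms(1,2,3) dh[OF that] \<Phi>])
      have eq: "partial_deriv [b] (\<lambda>x. h (\<Phi> x) *\<^sub>R c x) y
          = h (\<Phi> y) *\<^sub>R ?dc y + (\<Sum>e\<in>Basis. ?dh e (\<Phi> y) *\<^sub>R ?d\<Phi> e y)" if y: "y \<in> S" for y
      proof -
        let ?D = "frechet_derivative h (at (\<Phi> y))" and ?d = "frechet_derivative \<Phi> (at y)"
        have D: "(h has_derivative ?D) (at (\<Phi> y))"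
          by (rule Ck_on_has_derivative[OF h assms(3)[OF y]])
        have "((\<lambda>x. h (\<Phi> x)) has_derivative (\<lambda>v. ?D (?d v))) (at y)"
          using diff_chain_at[OF Ck_on_has_derivative[OF Suc.prems(1) y] D] by (simp add: o_def)
        from has_derivative_scaleR[OF this Ck_on_has_derivative[OF Suc.prems(2) y]]
        have "partial_deriv [b] (\<lambda>x. h (\<Phi> x) *\<^sub>R c x) y = h (\<Phi> y) *\<^sub>R ?dc y + ?D (?d b) *\<^sub>R c y"
          by (simp add: frechet_derivative_at[symmetric])
        moreover have "?D (?d b) = (\<Sum>e\<in>Basis. (?d b \<bullet> e) *\<^sub>R ?D e)"
          using linear_sum[OF has_derivative_linear[OF D], of "\<lambda>e. (?d b \<bullet> e) *\<^sub>R e" Basis]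
          by (simp add: euclidean_representation linear_scale[OF has_derivative_linear[OF D]])
        ultimately show ?thesis
          by (simp add: scaleR_sum_left mult.commute)
      qed
      have "partial_deriv \<alpha> (\<lambda>x. h (\<Phi> x) *\<^sub>R c x) x
          = partial_deriv \<beta> (\<lambda>y. h (\<Phi> y) *\<^sub>R ?dc y + (\<Sum>e\<in>Basis. ?dh e (\<Phi> y) *\<^sub>R ?d\<Phi> e y)) x"
        unfolding 2 partial_deriv_snoc by (rule partial_deriv_cong_open[OF assms(1) eq xS])
      also have "\<dots> = partial_deriv \<beta> (\<lambda>y. h (\<Phi> y) *\<^sub>R ?dc y) x
          + partial_deriv \<beta> (\<lambda>y. \<Sum>e\<in>Basis. ?dh e (\<Phi> y) *\<^sub>R ?d\<Phi> e y) x"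
        by (intro partial_deriv_add[OF assms(1) _ _ 2(3) xS] Ck_on_sum
            Ck_on_scaleR[OF assms(1) h\<Phi> dc] Ck_on_scaleR[OF assms(1) dh\<Phi> d\<Phi>] assms(1))
      also have "partial_deriv \<beta> (\<lambda>y. \<Sum>e\<in>Basis. ?dh e (\<Phi> y) *\<^sub>R ?d\<Phi> e y) x
          = (\<Sum>e\<in>Basis. partial_deriv \<beta> (\<lambda>y. ?dh e (\<Phi> y) *\<^sub>R ?d\<Phi> e y) x)"
        by (intro partial_deriv_sum[OF assms(1) _ 2(3) xS] Ck_on_scaleR[OF assms(1) dh\<Phi> d\<Phi>])
      finally have "norm (partial_deriv \<alpha> (\<lambda>x. h (\<Phi> x) *\<^sub>R c x) x)
          \<le> norm (partial_deriv \<beta> (\<lambda>y. h (\<Phi> y) *\<^sub>R ?dc y) x)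
            + norm (\<Sum>e\<in>Basis. partial_deriv \<beta> (\<lambda>y. ?dh e (\<Phi> y) *\<^sub>R ?d\<Phi> e y) x)"
        by (simp only: norm_triangle_ineq)
      also have "\<dots> \<le> C0 * B + (\<Sum>e\<in>Basis. C e * B)"
      proof (intro add_mono sum_norm_le C0 C x hn dh)
        show "\<forall>\<beta>\<in>multi_indices (enat n). \<bar>partial_deriv \<beta> h (\<Phi> x)\<bar> \<le> B"
          using B multi_indices_mono[of n "Suc n"] by auto
        show "\<forall>\<beta>\<in>multi_indices (enat n). \<bar>partial_deriv \<beta> (?dh e) (\<Phi> x)\<bar> \<le> B" if "e \<in> Basis" for e
        proof
          fix \<gamma> :: "'b list" assume "\<gamma> \<in> multi_indices (enat n)"
          from B[rule_format, OF multi_indices_snoc[OF this that]]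
          show "\<bar>partial_deriv \<gamma> (?dh e) (\<Phi> x)\<bar> \<le> B" by (simp add: partial_deriv_snoc)
        qed
      qed
      finally show "norm (partial_deriv \<alpha> (\<lambda>x. h (\<Phi> x) *\<^sub>R c x) x) \<le> (C0 + (\<Sum>e\<in>Basis. C e)) * B"
        by (simp add: distrib_right sum_distrib_right)
    qed
  qed
qed

section \<open>Global flows of Lipschitz fields\<close>

lemma has_vector_derivative_reflect:
  "(c has_vector_derivative v) (at (- t)) \<Longrightarrow> ((\<lambda>s. c (- s)) has_vector_derivative - v) (at (t::real))"
  using diff_chain_at[of uminus uminus t c "\<lambda>h. h *\<^sub>R v"]
  by (simp add: o_def has_vector_derivative_def has_derivative_minus[OF has_derivative_ident])

text \<open>The integral of L exp(2 L s) d over [0,t] is (exp(2 L t) - 1) d / 2. The exponent is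
  twice the Lipschitz constant so that a factor 1/2 remains, which becomes the contraction constant
  of the Picard operator.\<close>

lemma ode_weighted_bound_nonneg:
  fixes F :: "real \<Rightarrow> 'a::euclidean_space"
  assumes L: "L > 0" and t: "t \<ge> 0"
    and F: "\<And>s. (F has_vector_derivative f s) (at s)"
    and f: "\<And>s. s \<ge> 0 \<Longrightarrow> norm (f s) \<le> L * exp (2 * L * s) * d"
  shows "norm (F t - F 0) \<le> exp (2 * L * t) * d / 2"
proof (cases "t = 0")
  case True
  have "0 \<le> L * d" using order_trans[OF norm_ge_zero f[of 0]] by simp
  then show ?thesis using True L by (simp add: zero_le_mult_iff)
next
  case False
  have "0 \<le> L * d" using order_trans[OF norm_ge_zero f[of 0]] by simp
  then have d: "d \<ge> 0" using L by (simp add: zero_le_mult_iff)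
  have "norm (F t - F 0) \<le> exp (2 * L * t) * d / 2 - exp (2 * L * 0) * d / 2"
  proof (rule differentiable_bound_general)
    show "continuous_on {0..t} F"
      by (intro continuous_at_imp_continuous_on ballI has_vector_derivative_continuous[OF F])
    show "((\<lambda>t. exp (2 * L * t) * d / 2) has_vector_derivative L * exp (2 * L * s) * d) (at s)" for s
      by (auto intro!: derivative_eq_intros simp: has_real_derivative_iff_has_vector_derivative[symmetric])
  qed (use F f t False in \<open>auto intro!: continuous_intros\<close>)
  then show ?thesis using d by simp
qed

lemma ode_weighted_bound:
  fixes F :: "real \<Rightarrow> 'a::euclidean_space"
  assumes L: "L > 0"
    and F: "\<And>s. (F has_vector_derivative f s) (at s)"
    and f: "\<And>s. norm (f s) \<le> L * exp (2 * L * \<bar>s\<bar>) * d"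
  shows "norm (F t - F 0) \<le> exp (2 * L * \<bar>t\<bar>) * d / 2"
proof (cases "t \<ge> 0")
  case True
  have "norm (f s) \<le> L * exp (2 * L * s) * d" if "s \<ge> 0" for s
    using f[of s] that by simp
  from ode_weighted_bound_nonneg[OF L True F this] True show ?thesis by simp
next
  case False
  have "norm (- f (- s)) \<le> L * exp (2 * L * s) * d" if "s \<ge> 0" for s
    using f[of "- s"] that by simp
  from ode_weighted_bound_nonneg[OF L _ has_vector_derivative_reflect[OF F] this, of "- t"] False
  show ?thesis by simp
qed

text \<open>The Picard operator, written for \<open>u(t) = e\<^bsup>-2L|t|\<^esup> (c(t) - x)\<close>, is a contraction of the space of
  bounded continuous functions on the whole line; this yields global solutions at once.\<close>

lemma global_solution_exists:
  fixes X :: "'a::euclidean_space \<Rightarrow> 'a"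
  assumes L: "L > 0" and lip: "\<And>x y. norm (X x - X y) \<le> L * norm (x - y)"
    and bd: "\<And>x. norm (X x) \<le> B"
  shows "\<exists>c. c 0 = x \<and> (\<forall>s. (c has_vector_derivative X (c s)) (at s))"
proof -
  define w where "w t = exp (2 * L * \<bar>t\<bar>)" for t :: real
  have w: "w t > 0" "w t \<ge> 1" "continuous_on UNIV w" for t
    using L unfolding w_def by (auto intro!: continuous_intros)
  have contX: "continuous_on UNIV X"
  proof (rule lipschitz_on_continuous_on)
    show "L-lipschitz_on UNIV X"
      using L lip by (auto simp: lipschitz_on_def dist_norm)
  qed
  \<comment> \<open>The Picard integral of \<open>X\<close> along the curve x + w u, realised as an
    antiderivative vanishing at 0 so that positive and negative times are treated alike.\<close>
  define G where "G u = (SOME F. F 0 = 0 \<and> (\<forall>t. (F has_vector_derivative X (x + w t *\<^sub>R apply_bcontfun u t)) (at t)))"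
    for u :: "real \<Rightarrow>\<^sub>C 'a"
  have G: "G u 0 = 0" "(G u has_vector_derivative X (x + w t *\<^sub>R apply_bcontfun u t)) (at t)" for u t
  proof -
    let ?f = "\<lambda>t. X (x + w t *\<^sub>R apply_bcontfun u t)"
    have "continuous_on UNIV ?f"
      by (rule continuous_on_compose2[OF contX]) (auto intro!: continuous_intros w)
    then have "\<And>t. isCont ?f t"
      by (simp add: continuous_on_eq_continuous_at)
    then obtain F where F: "\<And>t. (F has_vector_derivative ?f t) (at t)"
      using einterval_antiderivative[of "-\<infinity>" "\<infinity>" ?f] by auto
    have "\<exists>F. F 0 = 0 \<and> (\<forall>t. (F has_vector_derivative ?f t) (at t))"
      by (rule exI[of _ "\<lambda>t. F t - F 0"]) (auto intro!: derivative_eq_intros F)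
    from someI_ex[OF this, folded G_def]
    show "G u 0 = 0" "(G u has_vector_derivative X (x + w t *\<^sub>R apply_bcontfun u t)) (at t)" by auto
  qed
  have cont: "continuous_on UNIV (G u)" for u
    by (intro continuous_at_imp_continuous_on ballI has_vector_derivative_continuous[OF G(2)])
  have bound: "norm (G u t) \<le> w t * (\<bar>B\<bar> / L) / 2" for u t
  proof -
    \<comment> \<open>With \<open>d = \<bar>B\<bar> / L\<close> the bound on \<open>X\<close> takes
      the weighted form, because the weight is at least 1. It keeps the rescaled Picard integral
      bounded, as the function space requires.\<close>
    have "norm (X (x + w s *\<^sub>R apply_bcontfun u s)) \<le> L * exp (2 * L * \<bar>s\<bar>) * (\<bar>B\<bar> / L)" for s
    proof -
      have "norm (X (x + w s *\<^sub>R apply_bcontfun u s)) \<le> \<bar>B\<bar> * 1"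
        using bd[of "x + w s *\<^sub>R apply_bcontfun u s"] by simp
      also have "\<dots> \<le> \<bar>B\<bar> * w s"
        by (intro mult_left_mono w) simp
      finally show ?thesis using L by (simp add: w_def mult.commute)
    qed
    from ode_weighted_bound[OF L G(2) this, of t] show ?thesis
      by (simp add: G(1) w_def)
  qed
  define T where "T u = Bcontfun (\<lambda>t. inverse (w t) *\<^sub>R G u t)" for u
  have T: "apply_bcontfun (T u) = (\<lambda>t. inverse (w t) *\<^sub>R G u t)" for u
    unfolding T_def
  proof (rule Bcontfun_inverse, rule bcontfun_normI)
    show "continuous_on UNIV (\<lambda>t. inverse (w t) *\<^sub>R G u t)"
      using less_imp_neq[OF w(1)] by (intro continuous_intros w cont) (metis UNIV_I)
    show "norm (inverse (w t) *\<^sub>R G u t) \<le> \<bar>B\<bar> / L / 2" for t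
      using bound[of u t] w(1)[of t] L by (simp add: field_simps)
  qed
  have "dist (T u) (T v) \<le> 1/2 * dist u v" for u v
  proof (rule dist_bound)
    fix t
    let ?f = "\<lambda>u t. X (x + w t *\<^sub>R apply_bcontfun u t)"
    have der: "((\<lambda>t. G u t - G v t) has_vector_derivative (?f u s - ?f v s)) (at s)" for s
      by (intro derivative_intros G)
    have "norm (?f u s - ?f v s) \<le> L * exp (2 * L * \<bar>s\<bar>) * dist u v" for s
    proof -
      have "norm (?f u s - ?f v s) \<le> L * norm (w s *\<^sub>R (apply_bcontfun u s - apply_bcontfun v s))"
        using lip[of "x + w s *\<^sub>R apply_bcontfun u s" "x + w s *\<^sub>R apply_bcontfun v s"]
        by (simp add: scaleR_diff_right)
      also have "\<dots> = L * (w s * dist (apply_bcontfun u s) (apply_bcontfun v s))"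
        using w(1)[of s] by (simp add: dist_norm)
      also have "\<dots> \<le> L * (w s * dist u v)"
        using L w(1)[of s] by (intro mult_left_mono dist_bounded) auto
      finally show ?thesis by (simp add: w_def mult.assoc)
    qed
    from ode_weighted_bound[OF L der this, of t]
    have "norm (G u t - G v t) \<le> w t * dist u v / 2" by (simp add: G w_def)
    moreover have "dist (apply_bcontfun (T u) t) (apply_bcontfun (T v) t) = inverse (w t) * norm (G u t - G v t)"
      using w(1)[of t] by (simp add: T dist_norm flip: scaleR_diff_right)
    moreover have "inverse (w t) * norm (G u t - G v t) \<le> inverse (w t) * (w t * dist u v / 2)"
      using calculation(1) w(1)[of t] by (intro mult_left_mono) auto
    moreover have "inverse (w t) * (w t * dist u v / 2) = 1/2 * dist u v"
      using w(1)[of t] by simp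
    ultimately show "dist (apply_bcontfun (T u) t) (apply_bcontfun (T v) t) \<le> 1/2 * dist u v"
      by linarith
  qed
  then obtain u where u: "T u = u"
    using banach_fix_type[of "1/2" T] by auto
  \<comment> \<open>At the fixed point the rescaling is undone: the curve x + w u equals x + G u,
    whose derivative is \<open>X\<close> along the curve itself.\<close>
  have "w t *\<^sub>R apply_bcontfun u t = G u t" for t
    using T[of u] w(1)[of t] unfolding u by (simp add: fun_eq_iff)
  then have "((\<lambda>t. x + G u t) has_vector_derivative X (x + G u t)) (at t)" for t
    using G(2)[of u t] by (auto intro!: derivative_eq_intros)
  then show ?thesis
    by (intro exI[of _ "\<lambda>t. x + G u t"]) (simp add: G)
qed

section \<open>Uniqueness of integral curves and the flow\<close>

text \<open>By Cauchy-Schwarz the squared distance q of two solutions satisfies q' \<le> 2 L q, so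
  exp(-2 L s) q(s) does not increase, and it starts at 0. The square is used because the distance
  need not be differentiable at its zeros.\<close>

lemma solution_unique_nonneg:
  fixes X :: "'a::euclidean_space \<Rightarrow> 'a"
  assumes lip: "\<And>x y. norm (X x - X y) \<le> L * norm (x - y)"
    and c: "\<And>s. (c has_vector_derivative X (c s)) (at s)"
    and d: "\<And>s. (d has_vector_derivative X (d s)) (at s)"
    and eq: "c 0 = d 0" and t: "t \<ge> 0"
  shows "c t = d t"
proof -
  define q where "q s = (c s - d s) \<bullet> (c s - d s)" for s
  have q: "(q has_real_derivative 2 * ((X (c s) - X (d s)) \<bullet> (c s - d s))) (at s)" for s
  proof -
    have D: "((\<lambda>s. c s - d s) has_derivative (\<lambda>h. h *\<^sub>R (X (c s) - X (d s)))) (at s)"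
      using has_vector_derivative_diff[OF c d] by (simp add: has_vector_derivative_def)
    have "(q has_derivative (\<lambda>h. (c s - d s) \<bullet> (h *\<^sub>R (X (c s) - X (d s))) +
        (h *\<^sub>R (X (c s) - X (d s))) \<bullet> (c s - d s))) (at s)"
      unfolding q_def by (rule has_derivative_inner[OF D D])
    then show ?thesis
      unfolding has_field_derivative_def
      by (rule back_subst[where P="\<lambda>D. (q has_derivative D) (at s)"])
        (simp add: fun_eq_iff inner_commute)
  qed
  let ?g = "\<lambda>s. exp (- (2 * L * s)) * q s"
  have "?g t \<le> ?g 0"
  proof (rule DERIV_nonpos_imp_nonincreasing[OF t])
    fix s
    let ?v = "exp (- (2 * L * s)) * (2 * ((X (c s) - X (d s)) \<bullet> (c s - d s)) - 2 * L * q s)"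
    have "(?g has_real_derivative ?v) (at s)"
      by (auto intro!: derivative_eq_intros q simp: algebra_simps)
    moreover have "(X (c s) - X (d s)) \<bullet> (c s - d s) \<le> L * q s"
    proof -
      have "(X (c s) - X (d s)) \<bullet> (c s - d s) \<le> norm (X (c s) - X (d s)) * norm (c s - d s)"
        by (rule norm_cauchy_schwarz)
      also have "\<dots> \<le> (L * norm (c s - d s)) * norm (c s - d s)"
        by (intro mult_right_mono lip) simp
      finally show ?thesis by (simp add: q_def dot_square_norm power2_eq_square)
    qed
    then have "?v \<le> 0" by (intro mult_nonneg_nonpos) auto
    ultimately show "\<exists>y. (?g has_real_derivative y) (at s) \<and> y \<le> 0" by blast
  qed
  then have "q t \<le> 0" using eq by (simp add: q_def mult_le_0_iff)
  then show ?thesis unfolding q_def by (metis inner_eq_zero_iff inner_ge_zero order_antisym right_minus_eq)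
qed

lemma solution_unique:
  fixes X :: "'a::euclidean_space \<Rightarrow> 'a"
  assumes lip: "\<And>x y. norm (X x - X y) \<le> L * norm (x - y)"
    and c: "\<And>s. (c has_vector_derivative X (c s)) (at s)"
    and d: "\<And>s. (d has_vector_derivative X (d s)) (at s)"
    and eq: "c 0 = d 0"
  shows "c t = d t"
proof (cases "t \<ge> 0")
  case True
  then show ?thesis using solution_unique_nonneg[of X L c d] assms by blast
next
  case False
  have lip': "norm (- X x - - X y) \<le> L * norm (x - y)" for x y
    using lip[of y x] by (simp add: norm_minus_commute)
  show ?thesis
    using solution_unique_nonneg[of "\<lambda>x. - X x" L "\<lambda>s. c (- s)" "\<lambda>s. d (- s)" "- t",
        OF lip' has_vector_derivative_reflect[OF c] has_vector_derivative_reflect[OF d]] eq False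
    by simp
qed

text \<open>\<open>flow\<close> is a definite description, so nothing can be said about it before
  existence and uniqueness are known. The last claim identifies the flow with an explicitly given
  integral curve.\<close>

lemma flow_solution:
  fixes X :: "'a::euclidean_space \<Rightarrow> 'a"
  assumes "L > 0" and lip: "\<And>x y. norm (X x - X y) \<le> L * norm (x - y)" and "\<And>x. norm (X x) \<le> B"
  shows "flow X 0 x = x" "((\<lambda>s. flow X s x) has_vector_derivative X (flow X s x)) (at s)"
    and "c 0 = x \<Longrightarrow> (\<And>s. (c has_vector_derivative X (c s)) (at s)) \<Longrightarrow> flow X t x = c t"
proof -
  obtain d where d: "d 0 = x" "\<And>s. (d has_vector_derivative X (d s)) (at s)"
    using global_solution_exists[OF assms] by blast
  have eq: "flow X t x = c t"
    if "c 0 = x" "\<And>s. (c has_vector_derivative X (c s)) (at s)" for c t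
  proof -
    have "(THE c. c 0 = x \<and> (\<forall>s. (c has_vector_derivative X (c s)) (at s))) = c"
    proof (rule the_equality)
      fix e assume "e 0 = x \<and> (\<forall>s. (e has_vector_derivative X (e s)) (at s))"
      then have e: "e 0 = x" "\<And>s. (e has_vector_derivative X (e s)) (at s)" by blast+
      show "e = c"
        by (rule ext) (rule solution_unique[OF lip e(2) that(2)], simp add: e(1) that(1))
    qed (use that in auto)
    then show ?thesis by (simp add: flow_def)
  qed
  have "flow X t x = d t" for t
    by (rule eq[OF d])
  then show "flow X 0 x = x" "((\<lambda>s. flow X s x) has_vector_derivative X (flow X s x)) (at s)"
    by (simp_all add: d)
  show "c 0 = x \<Longrightarrow> (\<And>s. (c has_vector_derivative X (c s)) (at s)) \<Longrightarrow> flow X t x = c t"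
    by (rule eq)
qed

text \<open>The hypothesis \<open>inv\<close> covers negative times, so the flow at time -t also
  maps \<open>M\<close> into itself. As the flow at time t undoes it, inclusion becomes
  equality.\<close>

lemma flow_image_invariant:
  fixes X :: "'a::euclidean_space \<Rightarrow> 'a"
  assumes X: "L > 0" "\<And>x y. norm (X x - X y) \<le> L * norm (x - y)" "\<And>x. norm (X x) \<le> B"
    and inv: "\<And>c t. (\<And>s. (c has_vector_derivative X (c s)) (at s)) \<Longrightarrow> c 0 \<in> M \<Longrightarrow> c t \<in> M"
  shows "flow X t ` M = M"
proof
  have in_M: "flow X t x \<in> M" if "x \<in> M" for t x
    using inv[of "\<lambda>s. flow X s x"] flow_solution(1,2)[OF X] that by simp
  then show "flow X t ` M \<subseteq> M" by blast
  show "M \<subseteq> flow X t ` M"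
  proof
    fix y assume y: "y \<in> M"
    \<comment> \<open>The equation is autonomous, so a time-shifted integral curve is again one.
      This one starts at \<open>flow X (- t) y\<close> and reaches \<open>y\<close> at time
      \<open>t\<close>.\<close>
    let ?c = "\<lambda>s. flow X (s - t) y"
    have "(?c has_vector_derivative X (?c s)) (at s)" for s
      using diff_chain_at[of "\<lambda>s. s - t" "\<lambda>h. h" s "\<lambda>s. flow X s y"]
        flow_solution(2)[OF X, where x=y and s="s - t"]
        has_derivative_diff[OF has_derivative_ident has_derivative_const, of t "at s"]
      by (auto simp: has_vector_derivative_def o_def)
    then have "flow X t (flow X (- t) y) = ?c t"
      by (intro flow_solution(3)[OF X, where c="?c"]) auto
    then have "y = flow X t (flow X (- t) y)"
      using flow_solution(1)[OF X] by simp
    then show "y \<in> flow X t ` M" using in_M[OF y] by blast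
  qed
qed

section \<open>Closed sets invariant under a flow\<close>

text \<open>The derivative of u^2 is bounded by 2 C u^2, so exp(-2 C s) u^2 is nonincreasing to the
  right of \<open>t0\<close> and exp(2 C s) u^2 is nondecreasing to the left. Both vanish at
  \<open>t0\<close>.\<close>

lemma gronwall_zero:
  fixes u :: "real \<Rightarrow> real"
  assumes u: "\<And>s. \<bar>s - t0\<bar> < \<delta> \<Longrightarrow> (u has_real_derivative u' s) (at s)"
    and bd: "\<And>s. \<bar>s - t0\<bar> < \<delta> \<Longrightarrow> \<bar>u' s\<bar> \<le> C * \<bar>u s\<bar>"
    and "u t0 = 0" "\<bar>t - t0\<bar> < \<delta>"
  shows "u t = 0"
proof -
  have q: "\<bar>u s * u' s\<bar> \<le> C * (u s * u s)" if "\<bar>s - t0\<bar> < \<delta>" for s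
  proof -
    have "\<bar>u s\<bar> * \<bar>u' s\<bar> \<le> \<bar>u s\<bar> * (C * \<bar>u s\<bar>)"
      using bd[OF that] by (intro mult_left_mono) auto
    also have "\<bar>u s\<bar> * (C * \<bar>u s\<bar>) = C * (u s * u s)"
      by (metis abs_mult_self_eq mult.left_commute)
    finally show ?thesis by (simp only: abs_mult)
  qed
  have der: "((\<lambda>s. exp (a * s) * (u s * u s)) has_real_derivative
      exp (a * s) * (a * (u s * u s) + 2 * (u s * u' s))) (at s)" if "\<bar>s - t0\<bar> < \<delta>" for a s
    by (auto intro!: derivative_eq_intros u that simp: algebra_simps)
  have "u t * u t \<le> 0"
  proof (cases "t \<ge> t0")
    case True
    have "exp (- 2 * C * t) * (u t * u t) \<le> exp (- 2 * C * t0) * (u t0 * u t0)"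
    proof (rule DERIV_nonpos_imp_nonincreasing[OF True])
      fix s assume "t0 \<le> s" "s \<le> t"
      then have s: "\<bar>s - t0\<bar> < \<delta>" using assms by auto
      have "exp (- 2 * C * s) * (- 2 * C * (u s * u s) + 2 * (u s * u' s)) \<le> 0"
        using q[OF s] by (intro mult_nonneg_nonpos exp_ge_zero) (simp add: mult.assoc abs_le_iff)
      with der[OF s] show "\<exists>y. ((\<lambda>s. exp (- 2 * C * s) * (u s * u s)) has_real_derivative y) (at s) \<and> y \<le> 0"
        by blast
    qed
    then show ?thesis using assms by (simp add: mult_le_0_iff)
  next
    case False
    have "exp (2 * C * t) * (u t * u t) \<le> exp (2 * C * t0) * (u t0 * u t0)"
    proof (rule DERIV_nonneg_imp_nondecreasing[of t t0])
      fix s assume "t \<le> s" "s \<le> t0"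
      then have s: "\<bar>s - t0\<bar> < \<delta>" using assms by auto
      have "0 \<le> exp (2 * C * s) * (2 * C * (u s * u s) + 2 * (u s * u' s))"
        using q[OF s] by (intro mult_nonneg_nonneg exp_ge_zero) (simp add: mult.assoc abs_le_iff)
      with der[OF s] show "\<exists>y. ((\<lambda>s. exp (2 * C * s) * (u s * u s)) has_real_derivative y) (at s) \<and> y \<ge> 0"
        by blast
    qed (use False in auto)
    then show ?thesis using assms by (simp add: mult_le_0_iff)
  qed
  then show ?thesis by (auto simp: mult_le_0_iff)
qed

text \<open>Near a frontier point \<open>a\<close> is a defining function of the frontier, and by Gronwall's inequality
  a curve that touches the frontier stays in it: the set of times spent there is open and closed.\<close>

lemma solution_stays_in_closed:
  fixes X :: "'a::euclidean_space \<Rightarrow> 'a"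
  assumes M: "closed M"
    and loc: "\<And>p. p \<in> frontier M \<Longrightarrow> \<exists>U a a' C. open U \<and> p \<in> U \<and>
      (\<forall>x\<in>U. (a has_derivative a' x) (at x) \<and> \<bar>a' x (X x)\<bar> \<le> C * \<bar>a x\<bar> \<and>
        (x \<in> frontier M \<longleftrightarrow> a x = (0::real)))"
    and c: "\<And>s. (c has_vector_derivative X (c s)) (at s)" and "c 0 \<in> M"
  shows "c t \<in> M"
proof -
  let ?Z = "c -` frontier M"
  have cont: "continuous_on UNIV c"
    by (intro continuous_at_imp_continuous_on ballI has_vector_derivative_continuous[OF c])
  have "closed ?Z"
    using cont by (intro closed_vimage) auto
  moreover have "open ?Z"
  proof (rule openI)
    fix t0 assume "t0 \<in> ?Z"
    then obtain U a a' C where U: "open U" "c t0 \<in> U" and a: "\<And>x. x \<in> U \<Longrightarrow>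
        (a has_derivative a' x) (at x) \<and> \<bar>a' x (X x)\<bar> \<le> C * \<bar>a x\<bar> \<and> (x \<in> frontier M \<longleftrightarrow> a x = (0::real))"
      using loc[of "c t0"] by blast
    have "open (c -` U)" using cont U(1) by (rule open_vimage[rotated])
    then obtain \<delta> where \<delta>: "\<delta> > 0" "ball t0 \<delta> \<subseteq> c -` U"
      using U(2) by (metis openE vimageI)
    have inU: "c s \<in> U" if "\<bar>s - t0\<bar> < \<delta>" for s
      using subsetD[OF \<delta>(2), of s] that by (simp add: dist_real_def abs_minus_commute)
    have "a (c s) = 0" if "\<bar>s - t0\<bar> < \<delta>" for s
    proof (rule gronwall_zero[where u="\<lambda>s. a (c s)" and u'="\<lambda>s. a' (c s) (X (c s))" and C=C, OF _ _ _ that])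
      fix s assume s: "\<bar>s - t0\<bar> < \<delta>"
      have lin: "linear (a' (c s))" using a[OF inU[OF s]] has_derivative_linear by blast
      show "((\<lambda>s. a (c s)) has_real_derivative a' (c s) (X (c s))) (at s)"
        using diff_chain_at[OF c[unfolded has_vector_derivative_def, of s], of a "a' (c s)"] a[OF inU[OF s]]
        by (simp add: o_def has_field_derivative_def linear_scale[OF lin] mult_commute_abs)
      show "\<bar>a' (c s) (X (c s))\<bar> \<le> C * \<bar>a (c s)\<bar>" using a[OF inU[OF s]] by blast
    next
      show "a (c t0) = 0" using a[OF U(2)] \<open>t0 \<in> ?Z\<close> by simp
    qed
    then have "ball t0 \<delta> \<subseteq> ?Z"
      using a inU by (auto simp: dist_real_def abs_minus_commute)
    with \<delta>(1) show "\<exists>e>0. ball t0 e \<subseteq> ?Z" by blast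
  qed
  ultimately consider "?Z = {}" | "?Z = UNIV" by (metis clopen)
  then show ?thesis
  proof cases
    case 1
    \<comment> \<open>A connected set that meets \<open>M\<close> and avoids its frontier cannot
      leave \<open>M\<close>.\<close>
    then have "range c \<inter> frontier M = {}" by blast
    moreover have "connected (range c)"
      using cont by (intro connected_continuous_image) auto
    ultimately show ?thesis
      using connected_Int_frontier[of "range c" M] \<open>c 0 \<in> M\<close> by blast
  next
    case 2
    then show ?thesis using M frontier_subset_closed by blast
  qed
qed

section \<open>Lipschitz bounds from continuous partial derivatives\<close>

lemma has_derivative_norm_bound:
  fixes f :: "'a::euclidean_space \<Rightarrow> 'b::real_normed_vector"
  assumes f: "(f has_derivative f') F" and C: "\<And>b. b \<in> Basis \<Longrightarrow> norm (f' b) \<le> C"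
  shows "norm (f' v) \<le> (real DIM('a) * C) * norm v"
proof -
  have lin: "linear f'" using f has_derivative_linear by blast
  have "f' v = (\<Sum>b\<in>Basis. (v \<bullet> b) *\<^sub>R f' b)"
    using linear_sum[OF lin, of "\<lambda>b. (v \<bullet> b) *\<^sub>R b" Basis]
    by (simp add: euclidean_representation linear_scale[OF lin])
  also have "norm \<dots> \<le> (\<Sum>b\<in>(Basis::'a set). norm v * C)"
    by (rule sum_norm_le) (auto intro!: mult_mono C Basis_le_norm)
  finally show ?thesis by (simp add: mult_ac)
qed

lemma Ck_on_lipschitz:
  fixes f :: "'a::euclidean_space \<Rightarrow> 'b::real_normed_vector"
  assumes "Ck_on (enat (Suc n)) S f" "convex K" "K \<subseteq> S"
    and C: "\<And>x b. x \<in> K \<Longrightarrow> b \<in> Basis \<Longrightarrow> norm (frechet_derivative f (at x) b) \<le> C"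
    and "x \<in> K" "y \<in> K"
  shows "norm (f x - f y) \<le> (real DIM('a) * C) * norm (x - y)"
proof (rule differentiable_bound[OF assms(2), where f'="\<lambda>x. frechet_derivative f (at x)"])
  fix z assume z: "z \<in> K"
  have d: "(f has_derivative frechet_derivative f (at z)) (at z)"
    using assms z by (intro Ck_on_has_derivative[OF assms(1)]) auto
  then show "(f has_derivative frechet_derivative f (at z)) (at z within K)"
    by (rule has_derivative_at_withinI)
  show "onorm (frechet_derivative f (at z)) \<le> real DIM('a) * C"
    by (rule onorm_le) (rule has_derivative_norm_bound[OF d C[OF z]])
qed (use assms in auto)

lemma Ck_on_lipschitz_compact:
  fixes f :: "'a::euclidean_space \<Rightarrow> 'b::real_normed_vector"
  assumes f: "Ck_on (enat (Suc n)) S f" and K: "convex K" "K \<subseteq> S" "compact K"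
  obtains C where "\<And>x y. x \<in> K \<Longrightarrow> y \<in> K \<Longrightarrow> norm (f x - f y) \<le> C * norm (x - y)"
proof -
  have "\<exists>C. \<forall>x\<in>K. norm (frechet_derivative f (at x) b) \<le> C" if "b \<in> Basis" for b
  proof -
    have "continuous_on K (\<lambda>x. frechet_derivative f (at x) b)"
      using Ck_on_continuous[OF Ck_on_frechet[OF f that]] K(2) continuous_on_subset by blast
    then have "bounded ((\<lambda>x. frechet_derivative f (at x) b) ` K)"
      using K(3) compact_continuous_image compact_imp_bounded by blast
    then show ?thesis by (auto simp: bounded_iff)
  qed
  then obtain C where C: "\<And>b x. b \<in> Basis \<Longrightarrow> x \<in> K \<Longrightarrow> norm (frechet_derivative f (at x) b) \<le> C b"
    by metis
  have "norm (frechet_derivative f (at x) b) \<le> (\<Sum>b\<in>Basis. \<bar>C b\<bar>)" if "b \<in> Basis" "x \<in> K" for x b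
    using C[OF that] member_le_sum[OF that(1), of "\<lambda>b. \<bar>C b\<bar>"] by fastforce
  with Ck_on_lipschitz[OF f K(1,2)] that show ?thesis by blast
qed

text \<open>The field and its first partial derivatives are continuous and vanish outside a ball,
  hence are bounded; bounded partial derivatives give a Lipschitz constant on the whole space, which
  is convex. Here the order has to be at least 1.\<close>

lemma Ckc_lipschitz_bounded:
  fixes X :: "'a::euclidean_space \<Rightarrow> 'a"
  assumes X: "X \<in> Ckc (enat (Suc n)) D"
  obtains L B where "L > 0" "\<And>x y. norm (X x - X y) \<le> L * norm (x - y)" "\<And>x. norm (X x) \<le> B"
proof -
  let ?K = "closure {x. X x \<noteq> 0}"
  have f: "Ck_on (enat (Suc n)) UNIV X" and "compact ?K" using X by (auto simp: Ckc_def)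
  then obtain R where "\<forall>x\<in>?K. norm x \<le> R"
    using compact_imp_bounded bounded_iff by blast
  then have R: "?K \<subseteq> cball 0 R" by (simp add: subset_iff)
  have zero: "X x = 0" if "x \<notin> cball 0 R" for x
    using that R closure_subset[of "{x. X x \<noteq> 0}"] by blast
  have bd: "\<exists>C. \<forall>x. norm (g x) \<le> C" if "continuous_on UNIV g" "\<And>x. x \<notin> cball 0 R \<Longrightarrow> g x = 0" for g :: "'a \<Rightarrow> 'a"
  proof -
    have "compact (g ` cball 0 R)"
      using that(1) by (intro compact_continuous_image) (auto intro: continuous_on_subset)
    then obtain C where "\<And>x. x \<in> cball 0 R \<Longrightarrow> norm (g x) \<le> C"
      by (meson bounded_iff compact_imp_bounded imageI)
    then have "norm (g x) \<le> \<bar>C\<bar>" for x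
      using that(2)[of x] by (cases "x \<in> cball 0 R") force+
    then show ?thesis by blast
  qed
  have "\<exists>C. \<forall>x. norm (frechet_derivative X (at x) b) \<le> C" if "b \<in> Basis" for b
  proof (rule bd)
    show "continuous_on UNIV (\<lambda>x. frechet_derivative X (at x) b)"
      using Ck_on_continuous[OF Ck_on_frechet[OF f that]] .
    show "frechet_derivative X (at x) b = 0" if "x \<notin> cball 0 R" for x
      using frechet_derivative_cong_open[OF open_Compl[OF closed_cball[of 0 R]], of X "\<lambda>x. 0" x] zero that by simp
  qed
  then obtain C where C: "\<And>b x. b \<in> Basis \<Longrightarrow> norm (frechet_derivative X (at x) b) \<le> C b"
    by metis
  have C': "norm (frechet_derivative X (at x) b) \<le> (\<Sum>b\<in>Basis. \<bar>C b\<bar>)" if "b \<in> Basis" for x b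
    using order_trans[OF C[OF that, of x]
        order_trans[OF abs_ge_self member_le_sum[OF that, of "\<lambda>b. \<bar>C b\<bar>"]]] by simp
  let ?L = "real DIM('a) * (\<Sum>b\<in>Basis. \<bar>C b\<bar>)"
  \<comment> \<open>The summand 1 makes the constant strictly positive even for the zero field,
    since the construction of the flow divides by it.\<close>
  have lip: "norm (X x - X y) \<le> (\<bar>?L\<bar> + 1) * norm (x - y)" for x y
  proof -
    have "norm (X x - X y) \<le> ?L * norm (x - y)"
      by (rule Ck_on_lipschitz[OF f convex_UNIV]) (auto intro: C')
    also have "\<dots> \<le> (\<bar>?L\<bar> + 1) * norm (x - y)" by (intro mult_right_mono) auto
    finally show ?thesis .
  qed
  obtain B where B: "\<And>x. norm (X x) \<le> B"
    using bd[OF Ck_on_continuous[OF f] zero] by blast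
  show ?thesis
    by (rule that[OF _ lip B]) (rule add_nonneg_pos[OF abs_ge_zero zero_less_one])
qed

section \<open>Boundary and normal field\<close>

lemma last_axis_in_Basis: "last_axis \<in> Basis"
  unfolding last_axis_def by (rule SOME_Basis)

lemma last_axis_inner_self [simp]: "last_axis \<bullet> last_axis = 1"
  by (simp add: last_axis_in_Basis)

lemma flatten_inner_last [simp]: "flatten y \<bullet> last_axis = 0"
  by (simp add: flatten_def inner_diff_left)

lemma flatten_id: "y \<in> half_space_bd \<Longrightarrow> flatten y = y"
  by (simp add: flatten_def half_space_bd_def)

lemma flatten_flatten [simp]: "flatten (flatten y) = flatten y"
  by (rule flatten_id) (simp add: half_space_bd_def)

lemma flatten_diff: "flatten (x - y) = flatten x - flatten y"
  by (simp add: flatten_def inner_diff_left algebra_simps)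

lemma bounded_linear_flatten: "bounded_linear flatten"
  unfolding flatten_def
  by (intro bounded_linear_sub bounded_linear_ident bounded_linear_scaleR_const bounded_linear_inner_left)

lemma norm_flatten_le: "norm (flatten y) \<le> norm y"
proof -
  have "flatten y \<bullet> flatten y \<le> y \<bullet> y"
    by (simp add: flatten_def inner_diff_left inner_diff_right inner_commute)
  then show ?thesis by (simp add: norm_le)
qed

lemma norm_minus_flatten: "norm (y - flatten y) = \<bar>y \<bullet> last_axis\<bar>"
  by (simp add: flatten_def norm_Basis last_axis_in_Basis)

text \<open>The gradient of the local defining function \<open>\<phi> x \<bullet> last_axis\<close>,
  that is, the adjoint of the derivative of \<open>\<phi>\<close> applied to
  \<open>last_axis\<close>. The expansion in partial derivatives makes its regularity, one order
  below that of the chart, immediate.\<close>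

definition chart_grad :: "('a::euclidean_space \<Rightarrow> 'a) \<Rightarrow> 'a \<Rightarrow> 'a" where
  "chart_grad \<phi> x = (\<Sum>b\<in>Basis. (frechet_derivative \<phi> (at x) b \<bullet> last_axis) *\<^sub>R b)"

lemma submfd_chartD:
  assumes "submfd_chart m M U V \<phi> \<psi>"
  shows "open U" "open V" "Ck_on m U \<phi>" "Ck_on m V \<psi>"
    "x \<in> U \<Longrightarrow> \<phi> x \<in> V" "y \<in> V \<Longrightarrow> \<psi> y \<in> U" "x \<in> U \<Longrightarrow> \<psi> (\<phi> x) = x" "y \<in> V \<Longrightarrow> \<phi> (\<psi> y) = y"
  using assms by (auto simp: submfd_chart_def homeomorphism_def)

text \<open>A chart only prescribes the image of \<open>U \<inter> M\<close>; injectivity of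
  \<open>\<phi>\<close> on \<open>U\<close> turns this into a pointwise criterion.\<close>

lemma chart_mem_iff:
  assumes "submfd_chart m M U V \<phi> \<psi>" "x \<in> U"
  shows "x \<in> M \<longleftrightarrow> \<phi> x \<bullet> last_axis \<ge> 0"
proof
  assume "x \<in> M"
  then have "\<phi> x \<in> half_space" using assms by (auto simp: submfd_chart_def)
  then show "\<phi> x \<bullet> last_axis \<ge> 0" by (simp add: half_space_def)
next
  assume "\<phi> x \<bullet> last_axis \<ge> 0"
  then have "\<phi> x \<in> \<phi> ` (U \<inter> M)"
    using assms submfd_chartD[OF assms(1)] by (auto simp: submfd_chart_def half_space_def)
  then obtain z where "\<phi> x = \<phi> z" "z \<in> U" "z \<in> M" by auto
  then show "x \<in> M" using submfd_chartD(7)[OF assms(1)] assms(2) by metis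
qed

lemma chart_grad_inner:
  assumes "submfd_chart (enat (Suc k)) M U V \<phi> \<psi>" "x \<in> U"
  shows "frechet_derivative \<phi> (at x) v \<bullet> last_axis = chart_grad \<phi> x \<bullet> v"
    and "((\<lambda>x. \<phi> x \<bullet> last_axis) has_derivative (\<lambda>v. chart_grad \<phi> x \<bullet> v)) (at x)"
proof -
  let ?D = "frechet_derivative \<phi> (at x)"
  have D: "(\<phi> has_derivative ?D) (at x)"
    by (rule Ck_on_has_derivative[OF submfd_chartD(3)[OF assms(1)] assms(2)])
  then have lin: "linear ?D" by (rule has_derivative_linear)
  show eq: "?D v \<bullet> last_axis = chart_grad \<phi> x \<bullet> v" for v
  proof -
    have "?D v = (\<Sum>b\<in>Basis. (v \<bullet> b) *\<^sub>R ?D b)"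
      using linear_sum[OF lin, of "\<lambda>b. (v \<bullet> b) *\<^sub>R b" Basis]
      by (simp add: euclidean_representation linear_scale[OF lin])
    then show ?thesis
      by (simp add: chart_grad_def inner_sum_left inner_commute[of v] mult.commute)
  qed
  show "((\<lambda>x. \<phi> x \<bullet> last_axis) has_derivative (\<lambda>v. chart_grad \<phi> x \<bullet> v)) (at x)"
    using has_derivative_inner_left[OF D, of last_axis] by (simp add: eq)
qed

text \<open>The derivative of \<open>\<phi>\<close> has that of \<open>\<psi>\<close> as a right
  inverse, so it sends some vector to \<open>last_axis\<close>. A vanishing gradient would make the
  last component of every image zero.\<close>

lemma chart_grad_nonzero:
  assumes "submfd_chart (enat (Suc k)) M U V \<phi> \<psi>" "x \<in> U"
  shows "chart_grad \<phi> x \<noteq> 0"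
proof
  assume 0: "chart_grad \<phi> x = 0"
  note ch = submfd_chartD[OF assms(1)]
  let ?D = "frechet_derivative \<phi> (at x)" and ?E = "frechet_derivative \<psi> (at (\<phi> x))"
  have "(\<phi> has_derivative ?D) (at (\<psi> (\<phi> x)))"
    using Ck_on_has_derivative[OF ch(3) assms(2)] ch(7) assms(2) by simp
  from diff_chain_at[OF Ck_on_has_derivative[OF ch(4) ch(5)[OF assms(2)]] this]
  have "((\<phi> \<circ> \<psi>) has_derivative (?D \<circ> ?E)) (at (\<phi> x))" .
  moreover have "((\<phi> \<circ> \<psi>) has_derivative (\<lambda>h. h)) (at (\<phi> x))"
    by (rule has_derivative_transform_within_open[OF has_derivative_ident ch(2) ch(5)[OF assms(2)]])
      (simp add: ch(8))
  ultimately have "?D \<circ> ?E = (\<lambda>h. h)"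
    by (rule has_derivative_unique)
  then have "?D (?E last_axis) = last_axis" by (simp add: fun_eq_iff)
  with chart_grad_inner(1)[OF assms, of "?E last_axis"] 0 show False by simp
qed

lemma Ck_on_chart_grad:
  assumes "submfd_chart (enat (Suc k)) M U V \<phi> \<psi>"
  shows "Ck_on (enat k) U (chart_grad \<phi>)"
  unfolding chart_grad_def
  using submfd_chartD[OF assms]
  by (intro Ck_on_sum Ck_on_scaleR Ck_on_const Ck_on_linear_compose[OF _ bounded_linear_inner_left] Ck_on_frechet)

text \<open>First-order comparison along a ray. It replaces computations with transition maps: two
  charts are compared on the points x + h v, whose membership in \<open>M\<close> does not depend on
  a chart.\<close>

lemma chart_directional:
  assumes "submfd_chart (enat (Suc k)) M U V \<phi> \<psi>" "x \<in> U" "\<phi> x \<bullet> last_axis = 0"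
  shows "chart_grad \<phi> x \<bullet> v > 0 \<Longrightarrow> \<exists>d>0. \<forall>h. 0 < h \<longrightarrow> h < d \<longrightarrow> \<phi> (x + h *\<^sub>R v) \<bullet> last_axis > 0"
    and "chart_grad \<phi> x \<bullet> v < 0 \<Longrightarrow> \<exists>d>0. \<forall>h. 0 < h \<longrightarrow> h < d \<longrightarrow> \<phi> (x + h *\<^sub>R v) \<bullet> last_axis < 0"
proof -
  have "((\<lambda>h. x + h *\<^sub>R v) has_derivative (\<lambda>h. h *\<^sub>R v)) (at 0)"
    by (auto intro!: derivative_eq_intros)
  from diff_chain_at[OF this, of "\<lambda>x. \<phi> x \<bullet> last_axis" "\<lambda>v. chart_grad \<phi> x \<bullet> v"]
  have d: "((\<lambda>h. \<phi> (x + h *\<^sub>R v) \<bullet> last_axis) has_real_derivative chart_grad \<phi> x \<bullet> v) (at 0)"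
    using chart_grad_inner(2)[OF assms(1,2)] by (simp add: o_def has_field_derivative_def mult_commute_abs)
  show "chart_grad \<phi> x \<bullet> v > 0 \<Longrightarrow> \<exists>d>0. \<forall>h. 0 < h \<longrightarrow> h < d \<longrightarrow> \<phi> (x + h *\<^sub>R v) \<bullet> last_axis > 0"
    using DERIV_pos_inc_right[OF d] assms(3) by simp
  show "chart_grad \<phi> x \<bullet> v < 0 \<Longrightarrow> \<exists>d>0. \<forall>h. 0 < h \<longrightarrow> h < d \<longrightarrow> \<phi> (x + h *\<^sub>R v) \<bullet> last_axis < 0"
    using DERIV_neg_dec_right[OF d] assms(3) by simp
qed

lemma open_ray_initial:
  fixes x v :: "'a::real_normed_vector"
  assumes "open S" "x \<in> S"
  shows "\<exists>d>0. \<forall>h. 0 < h \<longrightarrow> h < d \<longrightarrow> x + h *\<^sub>R v \<in> S"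
proof -
  have "open ((\<lambda>h. x + h *\<^sub>R v) -` S)"
    using assms(1) by (intro open_vimage) (auto intro!: continuous_intros)
  moreover have "0 \<in> (\<lambda>h. x + h *\<^sub>R v) -` S" using assms(2) by simp
  ultimately obtain d where "d > 0" "ball 0 d \<subseteq> (\<lambda>h. x + h *\<^sub>R v) -` S" by (rule openE)
  then show ?thesis
    by (intro exI[of _ d]) (auto simp: subset_iff dist_real_def)
qed

text \<open>Where the defining function is nonzero, its sign is constant nearby, so the point is
  interior to \<open>M\<close> or off its closure. At value 0 the point lies in \<open>M\<close>,
  while moving against the nonzero gradient leaves \<open>M\<close> at once.\<close>

lemma chart_frontier_iff:
  assumes "submfd_chart (enat (Suc k)) M U V \<phi> \<psi>" "x \<in> U"
  shows "x \<in> frontier M \<longleftrightarrow> \<phi> x \<bullet> last_axis = 0"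
proof -
  note ch = submfd_chartD[OF assms(1)]
  have cont: "continuous_on U (\<lambda>x. \<phi> x \<bullet> last_axis)"
    by (intro continuous_intros Ck_on_continuous[OF ch(3)])
  consider "\<phi> x \<bullet> last_axis > 0" | "\<phi> x \<bullet> last_axis < 0" | "\<phi> x \<bullet> last_axis = 0" by linarith
  then show ?thesis
  proof cases
    case 1
    have "open (U \<inter> (\<lambda>x. \<phi> x \<bullet> last_axis) -` {0<..})"
      by (rule continuous_open_preimage[OF cont ch(1) open_greaterThan])
    moreover have "U \<inter> (\<lambda>x. \<phi> x \<bullet> last_axis) -` {0<..} \<subseteq> M"
      using chart_mem_iff[OF assms(1)] by auto
    ultimately have "x \<in> interior M" using 1 assms(2) by (intro interiorI) auto
    then show ?thesis using 1 by (simp add: frontier_def)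
  next
    case 2
    have "open (U \<inter> (\<lambda>x. \<phi> x \<bullet> last_axis) -` {..<0})"
      by (rule continuous_open_preimage[OF cont ch(1) open_lessThan])
    moreover have "(U \<inter> (\<lambda>x. \<phi> x \<bullet> last_axis) -` {..<0}) \<inter> M = {}"
      using chart_mem_iff[OF assms(1)] by force
    ultimately have "(U \<inter> (\<lambda>x. \<phi> x \<bullet> last_axis) -` {..<0}) \<inter> closure M = {}"
      by (simp only: open_Int_closure_eq_empty)
    then have "x \<notin> closure M" using 2 assms(2) by blast
    then show ?thesis using 2 by (simp add: frontier_def)
  next
    case 3
    have "x \<notin> interior M"
    proof
      assume "x \<in> interior M"
      then obtain d where d: "d > 0" "\<And>h. 0 < h \<Longrightarrow> h < d \<Longrightarrow> x + h *\<^sub>R (- chart_grad \<phi> x) \<in> interior M \<inter> U"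
        using open_ray_initial[of "interior M \<inter> U" x] ch(1) assms(2) by (metis Int_iff open_Int open_interior)
      have "chart_grad \<phi> x \<bullet> (- chart_grad \<phi> x) < 0"
        using chart_grad_nonzero[OF assms] by simp
      from chart_directional(2)[OF assms 3 this]
      obtain e where e: "e > 0" "\<And>h. 0 < h \<Longrightarrow> h < e \<Longrightarrow> \<phi> (x + h *\<^sub>R (- chart_grad \<phi> x)) \<bullet> last_axis < 0"
        by blast
      define h where "h = min d e / 2"
      have h: "0 < h" "h < d" "h < e" using d(1) e(1) by (auto simp: h_def min_def)
      show False
        using chart_mem_iff[OF assms(1), of "x + h *\<^sub>R (- chart_grad \<phi> x)"] d(2)[OF h(1,2)] e(2)[OF h(1,3)]
          interior_subset[of M] by auto
    qed
    moreover have "x \<in> closure M"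
      using chart_mem_iff[OF assms] 3 closure_subset[of M] by auto
    ultimately show ?thesis using 3 by (simp add: frontier_def)
  qed
qed

text \<open>The frontier is free of charts, so \<open>mfd_boundary\<close>, which only asks for some
  chart, does not depend on which one is used. Closedness puts frontier points into
  \<open>M\<close>, where charts are available.\<close>

lemma mfd_boundary_eq_frontier:
  assumes "closed M" "submanifold (enat (Suc k)) M"
  shows "mfd_boundary (enat (Suc k)) M = frontier M"
proof
  show "mfd_boundary (enat (Suc k)) M \<subseteq> frontier M"
    using chart_frontier_iff by (fastforce simp: mfd_boundary_def half_space_bd_def)
  show "frontier M \<subseteq> mfd_boundary (enat (Suc k)) M"
  proof
    fix p assume p: "p \<in> frontier M"
    then have "p \<in> M" using assms(1) frontier_subset_closed by blast
    then obtain U V \<phi> \<psi> where ch: "p \<in> U" "submfd_chart (enat (Suc k)) M U V \<phi> \<psi>"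
      using assms(2) by (auto simp: submanifold_def)
    then have "\<phi> p \<in> half_space_bd"
      using chart_frontier_iff[OF ch(2,1)] p by (simp add: half_space_bd_def)
    then show "p \<in> mfd_boundary (enat (Suc k)) M"
      using ch \<open>p \<in> M\<close> by (auto simp: mfd_boundary_def)
  qed
qed

section \<open>Chart independence of the unit normal\<close>

text \<open>If the unit vectors differ, their inner product is below 1, and their difference lies
  strictly on the positive side of \<open>u\<close> and strictly on the negative side of
  \<open>v\<close>.\<close>

lemma sgn_eq_if_same_side:
  fixes u v :: "'a::real_inner"
  assumes "u \<noteq> 0" "v \<noteq> 0" and side: "\<And>w. u \<bullet> w > 0 \<Longrightarrow> v \<bullet> w \<ge> 0"
  shows "sgn u = sgn v"
proof (rule ccontr)
  assume ne: "sgn u \<noteq> sgn v"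
  have n: "sgn u \<bullet> sgn u = 1" "sgn v \<bullet> sgn v = 1"
    using assms by (simp_all add: dot_square_norm norm_sgn)
  have "(sgn u - sgn v) \<bullet> (sgn u - sgn v) > 0" using ne by simp
  then have lt: "sgn u \<bullet> sgn v < 1"
    using n by (simp add: inner_diff_left inner_diff_right inner_commute)
  have sc: "x \<bullet> d = norm x * (sgn x \<bullet> d)" if "x \<noteq> 0" for x d :: 'a
    using that by (simp add: sgn_div_norm)
  have "u \<bullet> (sgn u - sgn v) > 0"
    unfolding sc[OF assms(1)] using lt n assms by (simp add: inner_diff_right)
  from side[OF this] have "sgn v \<bullet> (sgn u - sgn v) \<ge> 0"
    unfolding sc[OF assms(2)] using assms by (simp add: zero_le_mult_iff)
  then show False using lt n by (simp add: inner_diff_right inner_commute)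
qed

lemma unit_normal_eq:
  fixes n g :: "'a::real_inner"
  assumes "norm n = 1" "\<And>v. g \<bullet> v = 0 \<Longrightarrow> n \<bullet> v = 0" "g \<bullet> n < 0"
  shows "n = - sgn g"
proof -
  have g: "g \<noteq> 0" using assms(3) by auto
  \<comment> \<open>\<open>c *\<^sub>R g\<close> is the orthogonal projection of \<open>n\<close> to
    the line of \<open>g\<close>. The remainder is orthogonal to \<open>g\<close>, by assumption
    then to \<open>n\<close>, and so to itself.\<close>
  define c where "c = (g \<bullet> n) / (g \<bullet> g)"
  have "g \<bullet> (n - c *\<^sub>R g) = 0" using g by (simp add: c_def inner_diff_right)
  with assms(2) have "n \<bullet> (n - c *\<^sub>R g) = 0" .
  then have "(n - c *\<^sub>R g) \<bullet> (n - c *\<^sub>R g) = 0"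
    using \<open>g \<bullet> (n - c *\<^sub>R g) = 0\<close> by (simp add: inner_diff_left)
  then have n: "n = c *\<^sub>R g" by simp
  have "c < 0" using assms(3) g by (simp add: c_def divide_neg_pos)
  moreover have "\<bar>c\<bar> * norm g = 1" using assms(1) n by simp
  ultimately have "c = - inverse (norm g)" using g by (simp add: field_simps)
  then show ?thesis using n by (simp add: sgn_div_norm)
qed

text \<open>Uniqueness in the definite description amounts to independence of the chart. A direction
  entering \<open>M\<close> to first order in one chart cannot leave it to first order in another,
  since both describe the same set; so the two gradients have the same direction.\<close>

lemma outward_unit_normal_chart:
  assumes ch: "submfd_chart (enat (Suc k)) M U V \<phi> \<psi>" and p: "p \<in> U" "\<phi> p \<bullet> last_axis = 0"
  shows "outward_unit_normal (enat (Suc k)) M p = - sgn (chart_grad \<phi> p)"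
  unfolding outward_unit_normal_def
proof (rule the_equality)
  have "chart_grad \<phi> p \<noteq> 0" by (rule chart_grad_nonzero[OF ch p(1)])
  then have "chart_grad \<phi> p \<bullet> - sgn (chart_grad \<phi> p) < 0"
    by (simp add: sgn_div_norm)
  moreover have "norm (- sgn (chart_grad \<phi> p)) = 1"
    using \<open>chart_grad \<phi> p \<noteq> 0\<close> by (simp add: norm_sgn)
  moreover have "- sgn (chart_grad \<phi> p) \<bullet> v = 0" if "chart_grad \<phi> p \<bullet> v = 0" for v
    using that by (simp add: sgn_div_norm)
  ultimately show "is_outward_unit_normal (enat (Suc k)) M p (- sgn (chart_grad \<phi> p))"
    unfolding is_outward_unit_normal_def half_space_bd_def
    using ch p chart_grad_inner(1)[OF ch p(1)]
    by (intro conjI exI[of _ U] exI[of _ V] exI[of _ \<phi>] exI[of _ \<psi>]) auto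
next
  fix n assume "is_outward_unit_normal (enat (Suc k)) M p n"
  then obtain U' V' \<phi>' \<psi>' where n: "norm n = 1" and ch': "p \<in> U'" "submfd_chart (enat (Suc k)) M U' V' \<phi>' \<psi>'"
    "\<phi>' p \<bullet> last_axis = 0" and orth: "\<And>v. frechet_derivative \<phi>' (at p) v \<bullet> last_axis = 0 \<Longrightarrow> n \<bullet> v = 0"
    and out: "frechet_derivative \<phi>' (at p) n \<bullet> last_axis < 0"
    unfolding is_outward_unit_normal_def half_space_bd_def by blast
  have "n = - sgn (chart_grad \<phi>' p)"
    using orth out unfolding chart_grad_inner(1)[OF ch'(2,1)] by (rule unit_normal_eq[OF n])
  moreover have "sgn (chart_grad \<phi> p) = sgn (chart_grad \<phi>' p)"
  proof (rule sgn_eq_if_same_side)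
    fix w assume "chart_grad \<phi> p \<bullet> w > 0"
    from chart_directional(1)[OF ch p this] obtain d1 where
      d1: "d1 > 0" "\<And>h. 0 < h \<Longrightarrow> h < d1 \<Longrightarrow> \<phi> (p + h *\<^sub>R w) \<bullet> last_axis > 0" by blast
    have "open (U \<inter> U')" "p \<in> U \<inter> U'"
      using submfd_chartD(1)[OF ch] submfd_chartD(1)[OF ch'(2)] p ch' by auto
    from open_ray_initial[OF this, of w] obtain d2 where
      d2: "d2 > 0" "\<And>h. 0 < h \<Longrightarrow> h < d2 \<Longrightarrow> p + h *\<^sub>R w \<in> U \<inter> U'" by blast
    show "chart_grad \<phi>' p \<bullet> w \<ge> 0"
    proof (rule ccontr)
      assume "\<not> ?thesis"
      then have "chart_grad \<phi>' p \<bullet> w < 0" by simp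
      from chart_directional(2)[OF ch'(2,1,3) this] obtain d3 where
        d3: "d3 > 0" "\<And>h. 0 < h \<Longrightarrow> h < d3 \<Longrightarrow> \<phi>' (p + h *\<^sub>R w) \<bullet> last_axis < 0" by blast
      define h where "h = min d1 (min d2 d3) / 2"
      have h: "0 < h" "h < d1" "h < d2" "h < d3" using d1(1) d2(1) d3(1) by (auto simp: h_def min_def)
      show False
        using d1(2)[OF h(1,2)] d2(2)[OF h(1,3)] d3(2)[OF h(1,4)]
          chart_mem_iff[OF ch, of "p + h *\<^sub>R w"] chart_mem_iff[OF ch'(2), of "p + h *\<^sub>R w"] by auto
    qed
  qed (use chart_grad_nonzero[OF ch p(1)] chart_grad_nonzero[OF ch'(2,1)] in auto)
  ultimately show "n = - sgn (chart_grad \<phi> p)" by simp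
qed

section \<open>Flows of tangential fields\<close>

text \<open>The derivative of the defining function along \<open>X\<close> is
  \<open>chart_grad \<phi> x \<bullet> X x\<close>, which vanishes on the frontier by tangency. It
  is at least of class C^1, so it is Lipschitz on a small ball in chart coordinates. Comparing a
  point with its flattened image bounds it by a multiple of the defining function, as Gronwall's
  inequality requires.\<close>

lemma flow_tangential:
  assumes M: "closed M" "submanifold (enat (Suc (Suc n))) M" and X: "X \<in> Ckc (enat (Suc n)) D"
    and tang: "\<And>p. p \<in> frontier M \<Longrightarrow> X p \<bullet> outward_unit_normal (enat (Suc (Suc n))) M p = 0"
  shows "flow X t ` M = M"
proof -
  obtain L B where LB: "L > 0" "\<And>x y. norm (X x - X y) \<le> L * norm (x - y)" "\<And>x. norm (X x) \<le> B"
    using Ckc_lipschitz_bounded[OF X] by blast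
  show ?thesis
  proof (rule flow_image_invariant[OF LB])
    fix c t assume c: "\<And>s. (c has_vector_derivative X (c s)) (at s)" "c 0 \<in> M"
    show "c t \<in> M"
    proof (rule solution_stays_in_closed[OF M(1) _ c])
      fix p assume p: "p \<in> frontier M"
      then have "p \<in> M" using M(1) frontier_subset_closed by blast
      then obtain U V \<phi> \<psi> where pU: "p \<in> U" and ch: "submfd_chart (enat (Suc (Suc n))) M U V \<phi> \<psi>"
        using M(2) by (auto simp: submanifold_def)
      note chD = submfd_chartD[OF ch]
      have p0: "\<phi> p \<bullet> last_axis = 0" using chart_frontier_iff[OF ch pU] p by simp
      let ?h = "\<lambda>x. chart_grad \<phi> x \<bullet> X x"
      have "Ck_on (enat (Suc n)) U X"
        using X by (auto simp: Ckc_def intro: Ck_on_subset)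
      then have h: "Ck_on (enat (Suc n)) U ?h"
        by (intro Ck_on_inner chD Ck_on_chart_grad[OF ch])
      have \<psi>: "Ck_on (enat (Suc n)) V \<psi>" by (rule Ck_on_mono[OF chD(4)]) simp
      have h\<psi>: "Ck_on (enat (Suc n)) V (\<lambda>y. ?h (\<psi> y))"
        by (rule Ck_on_compose[OF chD(2,1,6) h \<psi>])
      obtain r where r: "r > 0" "cball (\<phi> p) r \<subseteq> V"
        using open_contains_cball chD(2) chD(5)[OF pU] by blast
      obtain C where C: "\<And>x y. x \<in> cball (\<phi> p) r \<Longrightarrow> y \<in> cball (\<phi> p) r \<Longrightarrow>
          norm (?h (\<psi> x) - ?h (\<psi> y)) \<le> C * norm (x - y)"
        using Ck_on_lipschitz_compact[OF h\<psi> convex_cball r(2) compact_cball] by blast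
      \<comment> \<open>The centre lies in the flat boundary, where flattening is the identity, and
        flattening does not increase norms. So the ball contains the flattened images of its
        points.\<close>
      have flat: "flatten y \<in> cball (\<phi> p) r" if "y \<in> cball (\<phi> p) r" for y
      proof -
        have "\<phi> p - flatten y = flatten (\<phi> p - y)"
          using p0 by (simp add: flatten_diff flatten_id half_space_bd_def)
        then show ?thesis
          using that norm_flatten_le[of "\<phi> p - y"] by (simp add: dist_norm)
      qed
      have zero: "?h (\<psi> y) = 0" if "y \<in> V" "y \<bullet> last_axis = 0" for y
      proof -
        have \<psi>y: "\<psi> y \<in> U" "\<phi> (\<psi> y) \<bullet> last_axis = 0" using chD that by auto
        then have "\<psi> y \<in> frontier M" using chart_frontier_iff[OF ch] by blast
        from tang[OF this] show ?thesis
          using chart_grad_nonzero[OF ch \<psi>y(1)]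
          by (simp add: outward_unit_normal_chart[OF ch \<psi>y] sgn_div_norm inner_commute)
      qed
      let ?U = "U \<inter> \<phi> -` ball (\<phi> p) r"
      have "open ?U"
        by (rule continuous_open_preimage[OF Ck_on_continuous[OF chD(3)] chD(1) open_ball])
      moreover have "p \<in> ?U" using pU r by simp
      moreover have "\<bar>?h x\<bar> \<le> C * \<bar>\<phi> x \<bullet> last_axis\<bar>" if "x \<in> ?U" for x
      proof -
        have \<phi>x: "\<phi> x \<in> cball (\<phi> p) r" using that by auto
        have "norm (?h (\<psi> (\<phi> x)) - ?h (\<psi> (flatten (\<phi> x)))) \<le> C * norm (\<phi> x - flatten (\<phi> x))"
          by (rule C[OF \<phi>x flat[OF \<phi>x]])
        moreover have "?h (\<psi> (flatten (\<phi> x))) = 0"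
          using flat[OF \<phi>x] r(2) by (intro zero) auto
        ultimately show ?thesis
          using that chD(7)[of x] by (simp add: norm_minus_flatten)
      qed
      ultimately show "\<exists>U a a' C. open U \<and> p \<in> U \<and>
          (\<forall>x\<in>U. (a has_derivative a' x) (at x) \<and> \<bar>a' x (X x)\<bar> \<le> C * \<bar>a x\<bar> \<and>
            (x \<in> frontier M \<longleftrightarrow> a x = (0::real)))"
        using chart_grad_inner(2)[OF ch] chart_frontier_iff[OF ch]
        by (intro exI[of _ ?U] exI[of _ "\<lambda>x. \<phi> x \<bullet> last_axis"] exI[of _ "\<lambda>x v. chart_grad \<phi> x \<bullet> v"]
            exI[of _ C] conjI ballI) auto
    qed
  qed
qed

lemma eulerian_semideriv_tangential:
  assumes "closed M" "submanifold (enat (Suc (Suc n))) M" "X \<in> Ckc (enat (Suc n)) D"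
    and "\<And>p. p \<in> frontier M \<Longrightarrow> X p \<bullet> outward_unit_normal (enat (Suc (Suc n))) M p = 0"
  shows "eulerian_semideriv J M X = 0"
proof -
  have "difference_quotient J M X = (\<lambda>t. 0)"
    using flow_tangential[OF assms] by (simp add: difference_quotient_def fun_eq_iff)
  then show ?thesis
    by (simp add: eulerian_semideriv_def tendsto_Lim)
qed

section \<open>Extension of boundary functions\<close>

text \<open>Two open sets cover the space: \<open>S\<close>, where all factors are regular, and the
  complement of \<open>K\<close>, where the product is 0 whatever values \<open>h (\<Phi> x)\<close>
  takes there.\<close>

lemma Ck_on_compose_supported:
  fixes \<Phi> :: "'a::euclidean_space \<Rightarrow> 'b::euclidean_space" and c :: "'a \<Rightarrow> 'c::real_normed_vector"
    and h :: "'b \<Rightarrow> real"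
  assumes "open S" "open T" "\<And>x. x \<in> S \<Longrightarrow> \<Phi> x \<in> T" "closed K" "K \<subseteq> S" "\<And>x. x \<notin> K \<Longrightarrow> c x = 0"
    and "Ck_on (enat n) S \<Phi>" "Ck_on (enat n) S c" "Ck_on (enat n) T h"
  shows "Ck_on (enat n) UNIV (\<lambda>x. h (\<Phi> x) *\<^sub>R c x)"
proof -
  have "Ck_on (enat n) S (\<lambda>x. h (\<Phi> x))"
    by (rule Ck_on_compose[OF assms(1,2,3) assms(9,7)])
  then have "Ck_on (enat n) S (\<lambda>x. h (\<Phi> x) *\<^sub>R c x)"
    using assms by (intro Ck_on_scaleR)
  moreover have "Ck_on (enat n) (- K) (\<lambda>x. h (\<Phi> x) *\<^sub>R c x)"
    by (rule Ck_on_cong_open[OF open_Compl[OF assms(4)] _ Ck_on_const[of n _ 0]]) (simp add: assms(6))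
  ultimately have "Ck_on (enat n) (S \<union> - K) (\<lambda>x. h (\<Phi> x) *\<^sub>R c x)"
    using assms(1,4) by (intro Ck_on_Un_open) auto
  moreover have "S \<union> - K = UNIV" using assms(5) by blast
  ultimately show ?thesis by simp
qed

text \<open>Off \<open>K\<close> the product vanishes near the point, so the estimate on
  \<open>K\<close> becomes global. The constant is chosen before \<open>h\<close>, and the
  derivatives of \<open>h\<close> enter only on the compact image of \<open>K\<close>; their suprema
  there will be the boundary seminorms.\<close>

lemma partial_deriv_supported_bound:
  fixes \<Phi> :: "'a::euclidean_space \<Rightarrow> 'b::euclidean_space" and c :: "'a \<Rightarrow> 'c::real_normed_vector"
  assumes "open S" "open T" "\<And>x. x \<in> S \<Longrightarrow> \<Phi> x \<in> T" "compact K" "K \<subseteq> S" "\<And>x. x \<notin> K \<Longrightarrow> c x = 0"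
    and "Ck_on (enat n) S \<Phi>" "Ck_on (enat n) S c" "\<alpha> \<in> multi_indices (enat n)"
  shows "\<exists>C\<ge>0. \<forall>h::'b \<Rightarrow> real. \<forall>B\<ge>0. Ck_on (enat n) T h \<longrightarrow>
    (\<forall>y\<in>\<Phi> ` K. \<forall>\<beta>\<in>multi_indices (enat n). \<bar>partial_deriv \<beta> h y\<bar> \<le> B) \<longrightarrow>
    (\<forall>x. norm (partial_deriv \<alpha> (\<lambda>x. h (\<Phi> x) *\<^sub>R c x) x) \<le> C * B)"
proof -
  obtain C where "C \<ge> 0" and C: "\<And>h x B. x \<in> K \<Longrightarrow> Ck_on (enat n) T h \<Longrightarrow>
    (\<forall>\<beta>\<in>multi_indices (enat n). \<bar>partial_deriv \<beta> h (\<Phi> x)\<bar> \<le> B) \<Longrightarrow>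
    norm (partial_deriv \<alpha> (\<lambda>x. h (\<Phi> x) *\<^sub>R c x) x) \<le> C * B"
    using partial_deriv_compose_bound[OF assms(1-5,7-9)] by auto
  show ?thesis
  proof (intro exI[of _ C] conjI allI impI \<open>C \<ge> 0\<close>)
    fix h :: "'b \<Rightarrow> real" and B :: real and x
    assume h: "B \<ge> 0" "Ck_on (enat n) T h"
      "\<forall>y\<in>\<Phi> ` K. \<forall>\<beta>\<in>multi_indices (enat n). \<bar>partial_deriv \<beta> h y\<bar> \<le> B"
    show "norm (partial_deriv \<alpha> (\<lambda>x. h (\<Phi> x) *\<^sub>R c x) x) \<le> C * B"
    proof (cases "x \<in> K")
      case True
      then show ?thesis using h by (intro C) auto
    next
      case False
      have "partial_deriv \<alpha> (\<lambda>x. h (\<Phi> x) *\<^sub>R c x) x = partial_deriv \<alpha> (\<lambda>x. 0) x"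
        by (rule partial_deriv_cong_open[OF open_Compl[OF compact_imp_closed[OF assms(4)]]])
          (use False assms(6) in auto)
      then show ?thesis using h(1) \<open>C \<ge> 0\<close> by (simp add: partial_deriv_zero)
    qed
  qed
qed

section \<open>Partitions of unity of class C^k\<close>

text \<open>The exponent \<open>k + 1\<close> is the least for which the positive part of a
  polynomial is covered by \<open>Ck_on_pos_part_power\<close> at order \<open>k\<close>. The
  squared distance keeps the polynomial smooth at \<open>p\<close>.\<close>

definition bump :: "nat \<Rightarrow> 'a::euclidean_space \<Rightarrow> real \<Rightarrow> 'a \<Rightarrow> real" where
  "bump k p r x = max 0 (r\<^sup>2 - (x - p) \<bullet> (x - p)) ^ Suc k"

lemma Ck_on_bump: "Ck_on (enat k) UNIV (bump k p r)"
  unfolding bump_def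
  by (intro Ck_on_pos_part_power Ck_on_diff Ck_on_const Ck_on_inner Ck_on_bounded_linear[OF bounded_linear_ident])
    auto

lemma bump_nonneg: "bump k p r x \<ge> 0"
  by (simp add: bump_def)

lemma bump_pos: "x \<in> ball p r \<Longrightarrow> bump k p r x > 0"
  by (simp add: bump_def dot_square_norm dist_norm norm_minus_commute power_strict_mono)

lemma bump_eq_0:
  assumes "r \<ge> 0" "x \<notin> cball p r" shows "bump k p r x = 0"
proof -
  have "r\<^sup>2 \<le> (norm (x - p))\<^sup>2"
    using assms by (intro power_mono) (auto simp: dist_norm norm_minus_commute)
  then show ?thesis by (simp add: bump_def dot_square_norm)
qed

text \<open>Dividing by \<open>s + max 0 (\<epsilon> - s) ^ Suc k\<close> instead of the sum \<open>s\<close> of the bumps avoids zeros of the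
  denominator away from \<open>F\<close>, where \<open>s \<ge> \<epsilon>\<close>.\<close>

lemma partition_of_unity_Ck:
  fixes r :: "'a::euclidean_space \<Rightarrow> real"
  assumes I: "finite I" "\<And>p. p \<in> I \<Longrightarrow> r p > 0" and F: "compact F" "F \<subseteq> (\<Union>p\<in>I. ball p (r p))"
  obtains \<theta> :: "'a \<Rightarrow> 'a \<Rightarrow> real" where "\<And>p. Ck_on (enat k) UNIV (\<theta> p)"
    "\<And>p x. p \<in> I \<Longrightarrow> x \<notin> cball p (r p) \<Longrightarrow> \<theta> p x = 0" "\<And>x. x \<in> F \<Longrightarrow> (\<Sum>p\<in>I. \<theta> p x) = 1"
proof -
  define s where "s x = (\<Sum>p\<in>I. bump k p (r p) x)" for x
  have s: "Ck_on (enat k) UNIV s"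
    unfolding s_def by (intro Ck_on_sum Ck_on_bump open_UNIV)
  have s_nonneg: "s x \<ge> 0" for x
    unfolding s_def by (intro sum_nonneg bump_nonneg)
  have s_pos: "s x > 0" if x: "x \<in> F" for x
  proof -
    obtain p where "p \<in> I" "x \<in> ball p (r p)" using F(2) x by blast
    then show ?thesis
      unfolding s_def by (intro sum_pos2[OF I(1) _ bump_pos bump_nonneg])
  qed
  \<comment> \<open>The minimum of \<open>s\<close> on the compact set \<open>F\<close>; for empty
    \<open>F\<close> any positive number serves.\<close>
  obtain \<epsilon> where \<epsilon>: "\<epsilon> > 0" "\<And>x. x \<in> F \<Longrightarrow> \<epsilon> \<le> s x"
  proof (cases "F = {}")
    case True
    then show ?thesis using that[of 1] by simp
  next
    case False
    have "continuous_on F s" using Ck_on_continuous[OF s] continuous_on_subset by blast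
    from continuous_attains_inf[OF F(1) False this] obtain x where "x \<in> F" "\<forall>y\<in>F. s x \<le> s y" by blast
    then show ?thesis using that[of "s x"] s_pos by blast
  qed
  define d where "d x = s x + max 0 (\<epsilon> - s x) ^ Suc k" for x
  have d_pos: "d x > 0" for x
  proof (cases "s x > 0")
    case True
    then show ?thesis by (simp add: d_def add_pos_nonneg)
  next
    case False
    then show ?thesis using s_nonneg[of x] \<epsilon>(1) by (simp add: d_def max_def)
  qed
  have "Ck_on (enat k) UNIV d"
    unfolding d_def
    by (intro Ck_on_add Ck_on_pos_part_power Ck_on_diff Ck_on_const s) auto
  \<comment> \<open>\<open>d\<close> is positive, so its norm is \<open>d\<close> itself; the norm
    is written so that \<open>Ck_on_inverse_norm\<close> applies.\<close>
  then have inv: "Ck_on (enat k) UNIV (\<lambda>x. inverse (norm (d x)))"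
    using less_imp_neq[OF d_pos] by (intro Ck_on_inverse_norm) (auto dest: sym)
  show ?thesis
  proof (rule that[of "\<lambda>p x. bump k p (r p) x * inverse (norm (d x))"])
    show "Ck_on (enat k) UNIV (\<lambda>x. bump k p (r p) x * inverse (norm (d x)))" for p
      by (intro Ck_on_mult Ck_on_bump inv open_UNIV)
    show "bump k p (r p) x * inverse (norm (d x)) = 0" if "p \<in> I" "x \<notin> cball p (r p)" for p x
      using bump_eq_0[of "r p" x p k] I(2)[OF that(1)] that(2) by simp
    show "(\<Sum>p\<in>I. bump k p (r p) x * inverse (norm (d x))) = 1" if "x \<in> F" for x
    proof -
      have "d x = s x" using \<epsilon>(2)[OF that] by (simp add: d_def max_def)
      then show ?thesis
        using s_pos[OF that] by (simp add: s_def flip: sum_distrib_right sum_divide_distrib)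
    qed
  qed
qed

text \<open>The extension evaluates boundary functions at
  \<open>\<psi> (flatten (\<phi> x))\<close>, so flattened images must remain in \<open>V\<close>.
  At a frontier point flattening changes nothing, hence this holds on a neighbourhood.\<close>

lemma boundary_chart_ball:
  assumes "closed M" "submanifold (enat (Suc k)) M" "open D" "p \<in> D" "p \<in> frontier M"
  shows "\<exists>r U V \<phi> \<psi>. r > 0 \<and> submfd_chart (enat (Suc k)) M U V \<phi> \<psi> \<and>
    cball p r \<subseteq> (U \<inter> (\<lambda>x. flatten (\<phi> x)) -` V) \<inter> D"
proof -
  have "p \<in> M" using assms frontier_subset_closed by blast
  then obtain U V \<phi> \<psi> where ch: "submfd_chart (enat (Suc k)) M U V \<phi> \<psi>" and p: "p \<in> U"
    using assms(2) by (auto simp: submanifold_def)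
  note chD = submfd_chartD[OF ch]
  have "open (U \<inter> (\<lambda>x. flatten (\<phi> x)) -` V)"
    by (rule continuous_open_preimage[OF _ chD(1,2)])
      (intro bounded_linear.continuous_on[OF bounded_linear_flatten] Ck_on_continuous[OF chD(3)])
  moreover have "flatten (\<phi> p) = \<phi> p"
    using chart_frontier_iff[OF ch p] assms(5) by (intro flatten_id) (simp add: half_space_bd_def)
  ultimately have "open ((U \<inter> (\<lambda>x. flatten (\<phi> x)) -` V) \<inter> D)" "p \<in> (U \<inter> (\<lambda>x. flatten (\<phi> x)) -` V) \<inter> D"
    using assms(3,4) p chD(5)[OF p] by auto
  then show ?thesis using ch open_contains_cball by metis
qed

section \<open>Sup-seminorms on compact sets\<close>

lemma norm_le_sup_seminorm:
  assumes "compact K" "continuous_on K (partial_deriv \<alpha> f)" "x \<in> K"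
  shows "norm (partial_deriv \<alpha> f x) \<le> sup_seminorm K \<alpha> f"
proof -
  have "compact ((\<lambda>x. norm (partial_deriv \<alpha> f x)) ` K)"
    using assms by (intro compact_continuous_image continuous_on_norm)
  then have "bdd_above (insert 0 ((\<lambda>x. norm (partial_deriv \<alpha> f x)) ` K))"
    by (simp add: bounded_imp_bdd_above compact_imp_bounded)
  then show ?thesis
    unfolding sup_seminorm_def using assms(3) by (intro cSup_upper) auto
qed

lemma sup_seminorm_le:
  assumes "0 \<le> B" "\<And>x. x \<in> K \<Longrightarrow> norm (partial_deriv \<alpha> f x) \<le> B"
  shows "sup_seminorm K \<alpha> f \<le> B"
  unfolding sup_seminorm_def using assms by (intro cSup_least) auto

lemma sup_seminorm_nonneg:
  assumes "compact K" "continuous_on K (partial_deriv \<alpha> f)"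
  shows "0 \<le> sup_seminorm K \<alpha> f"
proof (cases "K = {}")
  case False
  then obtain x where "x \<in> K" by blast
  then show ?thesis using norm_le_sup_seminorm[OF assms] norm_ge_zero order_trans by blast
qed (simp add: sup_seminorm_def)

lemma sup_seminorm_triangle:
  assumes "Ck_on (enat n) UNIV f" "Ck_on (enat n) UNIV g" "compact K" "\<alpha> \<in> multi_indices (enat n)"
  shows "sup_seminorm K \<alpha> (\<lambda>x. f x + g x) \<le> sup_seminorm K \<alpha> f + sup_seminorm K \<alpha> g"
proof -
  have c: "continuous_on K (partial_deriv \<alpha> f)" "continuous_on K (partial_deriv \<alpha> g)"
    using Ck_on_partial_continuous assms continuous_on_subset by blast+
  show ?thesis
  proof (rule sup_seminorm_le)
    show "0 \<le> sup_seminorm K \<alpha> f + sup_seminorm K \<alpha> g"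
      using c by (intro add_nonneg_nonneg sup_seminorm_nonneg assms(3))
    fix x assume x: "x \<in> K"
    have "norm (partial_deriv \<alpha> f x + partial_deriv \<alpha> g x) \<le> sup_seminorm K \<alpha> f + sup_seminorm K \<alpha> g"
      using c x by (intro norm_triangle_mono norm_le_sup_seminorm assms(3))
    then show "norm (partial_deriv \<alpha> (\<lambda>x. f x + g x) x) \<le> sup_seminorm K \<alpha> f + sup_seminorm K \<alpha> g"
      using partial_deriv_add[OF open_UNIV assms(1,2,4)] by simp
  qed
qed

section \<open>The extension operator and its estimates\<close>

text \<open>\<open>Ck_boundary\<close> without \<open>extensional\<close>: the topologies are given
  by seminorms of pointwise differences, and such a difference of extensional functions need not be
  \<open>undefined\<close> off the boundary.\<close>

definition boundary_Ck :: "enat \<Rightarrow> enat \<Rightarrow> 'a set \<Rightarrow> ('a::euclidean_space \<Rightarrow> real) \<Rightarrow> bool" where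
  "boundary_Ck m k M f \<longleftrightarrow> (\<forall>U V \<phi> \<psi>. submfd_chart m M U V \<phi> \<psi> \<longrightarrow>
     Ck_on k (flatten -` V) (\<lambda>y. f (\<psi> (flatten y))))"

lemma Ck_boundary_eq: "Ck_boundary m k M = {f \<in> extensional (mfd_boundary m M). boundary_Ck m k M f}"
  by (simp add: Ck_boundary_def boundary_Ck_def)

definition boundary_seminorms :: "enat \<Rightarrow> enat \<Rightarrow> 'a set \<Rightarrow> (('a::euclidean_space \<Rightarrow> real) \<Rightarrow> real) set" where
  "boundary_seminorms m k M = {(\<lambda>f. sup_seminorm K \<alpha> (\<lambda>y. f (\<psi> (flatten y)))) | K \<alpha> U V \<phi> \<psi>.
        submfd_chart m M U V \<phi> \<psi> \<and> compact K \<and> K \<subseteq> V \<inter> half_space_bd \<and> \<alpha> \<in> multi_indices k}"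

lemma open_flatten_vimage: "open V \<Longrightarrow> open (flatten -` V)"
  by (intro open_vimage linear_continuous_on bounded_linear_flatten)

text \<open>In a chart, \<open>f\<close> is continued constantly along the last coordinate and
  multiplied by the local unit field \<open>- sgn (chart_grad \<phi>)\<close>; a partition of unity
  adds the pieces. The first claim combines linearity with the fact that only values on the frontier
  matter. The last one bounds derivatives by finitely many boundary seminorms, which is the form in
  which continuity is proved.\<close>

lemma extension_operator:
  fixes M D :: "'a::euclidean_space set"
  assumes D: "open D" "M \<subseteq> D" and M: "closed M" "bounded M" "submanifold (enat (Suc k)) M"
  obtains E :: "('a \<Rightarrow> real) \<Rightarrow> 'a \<Rightarrow> 'a" and Q :: "(('a \<Rightarrow> real) \<Rightarrow> real) set" where
    "\<And>f g h a b. (\<And>p. p \<in> frontier M \<Longrightarrow> h p = a * f p + b * g p) \<Longrightarrow> E h = (\<lambda>x. a *\<^sub>R E f x + b *\<^sub>R E g x)"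
    "\<And>f. boundary_Ck (enat (Suc k)) (enat k) M f \<Longrightarrow> E f \<in> Ckc (enat k) D"
    "\<And>f p. p \<in> frontier M \<Longrightarrow> E f p \<bullet> outward_unit_normal (enat (Suc k)) M p = f p"
    "finite Q" "Q \<subseteq> boundary_seminorms (enat (Suc k)) (enat k) M"
    "\<And>\<alpha>. \<alpha> \<in> multi_indices (enat k) \<Longrightarrow> \<exists>C\<ge>0. \<forall>f. \<forall>B\<ge>0. boundary_Ck (enat (Suc k)) (enat k) M f \<longrightarrow>
      (\<forall>q\<in>Q. q f \<le> B) \<longrightarrow> (\<forall>x. norm (partial_deriv \<alpha> (E f) x) \<le> C * B)"
proof -
  let ?F = "frontier M"
  let ?S = "\<lambda>U V \<phi>. U \<inter> (\<lambda>x. flatten (\<phi> x)) -` V"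
  have FM: "?F \<subseteq> M" using M(1) by (rule frontier_subset_closed)
  have F: "compact ?F" using M(2) by (rule compact_frontier_bounded)
  \<comment> \<open>All chart data are packed into one tuple so that a single choice function
    selects them together.\<close>
  have "\<forall>p\<in>?F. \<exists>z. case z of (r, U, V, \<phi>, \<psi>) \<Rightarrow> r > 0 \<and> submfd_chart (enat (Suc k)) M U V \<phi> \<psi> \<and>
    cball p r \<subseteq> ?S U V \<phi> \<inter> D"
  proof
    fix p assume p: "p \<in> ?F"
    then have "p \<in> D" using FM D(2) by blast
    from boundary_chart_ball[OF M(1,3) D(1) this p] obtain r U V \<phi> \<psi> where
      "r > 0 \<and> submfd_chart (enat (Suc k)) M U V \<phi> \<psi> \<and> cball p r \<subseteq> ?S U V \<phi> \<inter> D" by metis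
    then show "\<exists>z. case z of (r, U, V, \<phi>, \<psi>) \<Rightarrow> r > 0 \<and> submfd_chart (enat (Suc k)) M U V \<phi> \<psi> \<and>
        cball p r \<subseteq> ?S U V \<phi> \<inter> D"
      by (intro exI[of _ "(r, U, V, \<phi>, \<psi>)"]) simp
  qed
  from bchoice[OF this] obtain z where z: "\<forall>p\<in>?F. case z p of (r, U, V, \<phi>, \<psi>) \<Rightarrow> r > 0 \<and>
    submfd_chart (enat (Suc k)) M U V \<phi> \<psi> \<and> cball p r \<subseteq> ?S U V \<phi> \<inter> D" ..
  define r where "r p = fst (z p)" for p
  define U where "U p = fst (snd (z p))" for p
  define V where "V p = fst (snd (snd (z p)))" for p
  define \<phi> where "\<phi> p = fst (snd (snd (snd (z p))))" for p
  define \<psi> where "\<psi> p = snd (snd (snd (snd (z p))))" for p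
  have r: "r p > 0" and ch: "submfd_chart (enat (Suc k)) M (U p) (V p) (\<phi> p) (\<psi> p)"
    and ball: "cball p (r p) \<subseteq> ?S (U p) (V p) (\<phi> p)" "cball p (r p) \<subseteq> D" if "p \<in> ?F" for p
    using bspec[OF z that] by (auto simp: r_def U_def V_def \<phi>_def \<psi>_def split: prod.splits)
  have "?F \<subseteq> (\<Union>p\<in>?F. ball p (r p))" using r by force
  from compactE_image[OF F _ this] obtain I where I: "I \<subseteq> ?F" "finite I" "?F \<subseteq> (\<Union>p\<in>I. ball p (r p))"
    by auto
  obtain \<theta> :: "'a \<Rightarrow> 'a \<Rightarrow> real" where \<theta>: "\<And>p. Ck_on (enat k) UNIV (\<theta> p)"
    "\<And>p x. p \<in> I \<Longrightarrow> x \<notin> cball p (r p) \<Longrightarrow> \<theta> p x = 0" "\<And>x. x \<in> ?F \<Longrightarrow> (\<Sum>p\<in>I. \<theta> p x) = 1"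
    using partition_of_unity_Ck[OF I(2) _ F I(3), of k] r I(1) by blast
  define c where "c p x = \<theta> p x *\<^sub>R (- sgn (chart_grad (\<phi> p) x))" for p x
  define \<Phi> where "\<Phi> p x = flatten (\<phi> p x)" for p x
  \<comment> \<open>\<open>\<Phi>\<close> is already flattened; the further \<open>flatten\<close>
    gives \<open>H\<close> exactly the form in which \<open>boundary_Ck\<close> and the seminorms
    read \<open>f\<close>.\<close>
  define H where "H f p y = f (\<psi> p (flatten y))" for f :: "'a \<Rightarrow> real" and p y
  define E where "E f x = (\<Sum>p\<in>I. H f p (\<Phi> p x) *\<^sub>R c p x)" for f x
  let ?S = "\<lambda>p. U p \<inter> \<Phi> p -` V p"
  let ?T = "\<lambda>p. flatten -` V p"
  let ?K = "\<lambda>p. cball p (r p)"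
  let ?P = "boundary_Ck (enat (Suc k)) (enat k) M"
  have chI: "submfd_chart (enat (Suc k)) M (U p) (V p) (\<phi> p) (\<psi> p)" if "p \<in> I" for p
    using ch I(1) that by blast
  note chD = submfd_chartD[OF chI]
  have T: "open (?T p)" if "p \<in> I" for p
    using chD(2)[OF that] by (rule open_flatten_vimage)
  have K: "?K p \<subseteq> ?S p" "?K p \<subseteq> D" if "p \<in> I" for p
    using ball I(1) that unfolding \<Phi>_def by blast+
  have S: "open (?S p)" and \<Phi>: "Ck_on (enat k) (?S p) (\<Phi> p)" if "p \<in> I" for p
  proof -
    have \<Phi>: "Ck_on (enat k) (U p) (\<Phi> p)"
      unfolding \<Phi>_def
      by (intro Ck_on_linear_compose[OF chD(1)[OF that] bounded_linear_flatten]
          Ck_on_mono[OF chD(3)[OF that]]) simp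
    then show "Ck_on (enat k) (?S p) (\<Phi> p)" by (rule Ck_on_subset) simp
    show "open (?S p)"
      by (rule continuous_open_preimage[OF Ck_on_continuous[OF \<Phi>] chD(1)[OF that] chD(2)[OF that]])
  qed
  have \<Phi>T: "\<Phi> p x \<in> ?T p" if "p \<in> I" "x \<in> ?S p" for p x
    using that by (simp add: \<Phi>_def)
  have c: "Ck_on (enat k) (?S p) (c p)" if "p \<in> I" for p
  proof -
    have "Ck_on (enat k) (U p) (\<lambda>x. \<theta> p x *\<^sub>R ((- inverse (norm (chart_grad (\<phi> p) x))) *\<^sub>R chart_grad (\<phi> p) x))"
      using chart_grad_nonzero[OF chI[OF that]]
      by (intro Ck_on_scaleR chD(1)[OF that] Ck_on_subset[OF \<theta>(1)]
          Ck_on_linear_compose[OF chD(1)[OF that] bounded_linear_minus[OF bounded_linear_ident]]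
          Ck_on_inverse_norm Ck_on_chart_grad[OF chI[OF that]]) auto
    then have "Ck_on (enat k) (U p) (c p)"
      by (simp add: c_def[abs_def] sgn_div_norm)
    then show ?thesis by (rule Ck_on_subset) simp
  qed
  have c0: "c p x = 0" if "p \<in> I" "x \<notin> ?K p" for p x
    using \<theta>(2)[OF that] by (simp add: c_def)
  \<comment> \<open>Wherever \<open>c p\<close> can be nonzero, \<open>f\<close> is evaluated at
    frontier points only. This is why \<open>E\<close> ignores values off the frontier,
    \<open>undefined\<close> included.\<close>
  have bdry: "\<psi> p (flatten (\<Phi> p x)) \<in> ?F" if "p \<in> I" "x \<in> ?K p" for p x
  proof -
    have "flatten (\<Phi> p x) \<in> V p" using K(1)[OF that(1)] that(2) by (auto simp: \<Phi>_def)
    then show ?thesis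
      using chart_frontier_iff[OF chI[OF that(1)]] chD(6,8)[OF that(1)] by simp
  qed
  have H: "Ck_on (enat k) (?T p) (H f p)" if "?P f" "p \<in> I" for f p
    using that chI unfolding boundary_Ck_def H_def[abs_def] by blast
  have lin: "E h = (\<lambda>x. a *\<^sub>R E f x + b *\<^sub>R E g x)" if "\<And>p. p \<in> ?F \<Longrightarrow> h p = a * f p + b * g p" for f g h a b
  proof
    fix x
    have "H h p (\<Phi> p x) *\<^sub>R c p x = a *\<^sub>R (H f p (\<Phi> p x) *\<^sub>R c p x) + b *\<^sub>R (H g p (\<Phi> p x) *\<^sub>R c p x)"
      if "p \<in> I" for p
    proof (cases "x \<in> ?K p")
      case True
      then show ?thesis
        using \<open>\<And>p. p \<in> ?F \<Longrightarrow> h p = a * f p + b * g p\<close>[OF bdry[OF that True]]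
        by (simp add: H_def algebra_simps)
    qed (simp add: c0[OF that])
    then show "E h x = a *\<^sub>R E f x + b *\<^sub>R E g x"
      by (simp add: E_def sum.distrib scaleR_sum_right)
  qed
  have summand: "Ck_on (enat k) UNIV (\<lambda>x. H f p (\<Phi> p x) *\<^sub>R c p x)" if "?P f" "p \<in> I" for f p
    by (rule Ck_on_compose_supported[OF S T \<Phi>T closed_cball K(1) c0 \<Phi> c H]) (use that in auto)
  have mem: "E f \<in> Ckc (enat k) D" if "?P f" for f
  proof -
    have cl: "closed (\<Union>p\<in>I. ?K p)" and co: "compact (\<Union>p\<in>I. ?K p)"
      using I(2) by (auto intro!: compact_UN compact_imp_closed)
    have "{x. E f x \<noteq> 0} \<subseteq> (\<Union>p\<in>I. ?K p)"
    proof
      fix x assume "x \<in> {x. E f x \<noteq> 0}"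
      then have "(\<Sum>p\<in>I. H f p (\<Phi> p x) *\<^sub>R c p x) \<noteq> 0" by (simp add: E_def)
      then obtain p where "p \<in> I" "H f p (\<Phi> p x) *\<^sub>R c p x \<noteq> 0" by (rule sum.not_neutral_contains_not_neutral)
      then have "p \<in> I" "c p x \<noteq> 0" by simp_all
      then show "x \<in> (\<Union>p\<in>I. ?K p)" using c0 by blast
    qed
    then have sub: "closure {x. E f x \<noteq> 0} \<subseteq> (\<Union>p\<in>I. ?K p)"
      using cl by (rule closure_minimal)
    have "Ck_on (enat k) UNIV (E f)"
      unfolding E_def[abs_def] by (intro Ck_on_sum open_UNIV summand that)
    moreover have "compact (closure {x. E f x \<noteq> 0})"
      using compact_Int_closed[OF co closed_closure, of "{x. E f x \<noteq> 0}"] sub by (simp add: Int_absorb1)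
    moreover have "closure {x. E f x \<noteq> 0} \<subseteq> D" using sub K(2) by blast
    ultimately show ?thesis by (simp add: Ckc_def)
  qed
  have normal: "E f p \<bullet> outward_unit_normal (enat (Suc k)) M p = f p" if p: "p \<in> ?F" for f p
  proof -
    let ?\<nu> = "outward_unit_normal (enat (Suc k)) M p"
    \<comment> \<open>At a frontier point all charts yield the same unit normal, so every piece
      contributes \<open>f p\<close> times its weight, and the weights sum to 1.\<close>
    have "(H f q (\<Phi> q p) *\<^sub>R c q p) \<bullet> ?\<nu> = f p * \<theta> q p" if q: "q \<in> I" for q
    proof (cases "p \<in> ?K q")
      case True
      then have pU: "p \<in> U q" using K(1)[OF q] by blast
      have 0: "\<phi> q p \<bullet> last_axis = 0" using chart_frontier_iff[OF chI[OF q] pU] p by simp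
      then have "flatten (\<phi> q p) = \<phi> q p" by (intro flatten_id) (simp add: half_space_bd_def)
      then have "H f q (\<Phi> q p) = f p" using chD(7)[OF q pU] by (simp add: H_def \<Phi>_def)
      moreover have "sgn (chart_grad (\<phi> q) p) \<bullet> sgn (chart_grad (\<phi> q) p) = 1"
        using chart_grad_nonzero[OF chI[OF q] pU] by (simp add: dot_square_norm norm_sgn)
      ultimately show ?thesis
        by (simp add: c_def outward_unit_normal_chart[OF chI[OF q] pU 0])
    next
      case False
      then show ?thesis using c0[OF q] \<theta>(2)[OF q] by simp
    qed
    then have "E f p \<bullet> ?\<nu> = (\<Sum>q\<in>I. f p * \<theta> q p)"
      by (simp add: E_def inner_sum_left)
    then show ?thesis using \<theta>(3)[OF p] by (simp flip: sum_distrib_left)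
  qed
  \<comment> \<open>The images of the closed balls are compact and lie in the flat part of the
    charts, so these are admissible seminorms. Finitely many balls and multi-indices give a finite
    family.\<close>
  define Q :: "(('a \<Rightarrow> real) \<Rightarrow> real) set" where "Q = (\<lambda>(p, \<beta>) f. sup_seminorm (\<Phi> p ` ?K p) \<beta> (\<lambda>y. f (\<psi> p (flatten y)))) `
    (I \<times> multi_indices (enat k))"
  have finQ: "finite Q"
    unfolding Q_def by (intro finite_imageI finite_cartesian_product I(2) finite_multi_indices)
  have cK: "compact (\<Phi> p ` ?K p)" if "p \<in> I" for p
    using Ck_on_continuous[OF \<Phi>[OF that]] K(1)[OF that]
    by (intro compact_continuous_image compact_cball) (rule continuous_on_subset)
  have subK: "\<Phi> p ` ?K p \<subseteq> V p \<inter> half_space_bd" if "p \<in> I" for p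
    using K(1)[OF that] by (auto simp: \<Phi>_def half_space_bd_def)
  have subQ: "Q \<subseteq> boundary_seminorms (enat (Suc k)) (enat k) M"
  proof
    fix q assume "q \<in> Q"
    then obtain p \<beta> where "p \<in> I" "\<beta> \<in> multi_indices (enat k)"
      "q = (\<lambda>f. sup_seminorm (\<Phi> p ` ?K p) \<beta> (\<lambda>y. f (\<psi> p (flatten y))))"
      by (auto simp: Q_def)
    then show "q \<in> boundary_seminorms (enat (Suc k)) (enat k) M"
      unfolding boundary_seminorms_def using chI cK subK by blast
  qed
  have bound: "\<exists>C\<ge>0. \<forall>f. \<forall>B\<ge>0. ?P f \<longrightarrow> (\<forall>q\<in>Q. q f \<le> B) \<longrightarrow>
      (\<forall>x. norm (partial_deriv \<alpha> (E f) x) \<le> C * B)" if \<alpha>: "\<alpha> \<in> multi_indices (enat k)" for \<alpha>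
  proof -
    have "\<forall>p\<in>I. \<exists>C. C \<ge> 0 \<and> (\<forall>h::'a \<Rightarrow> real. \<forall>B\<ge>0. Ck_on (enat k) (?T p) h \<longrightarrow>
      (\<forall>y\<in>\<Phi> p ` ?K p. \<forall>\<beta>\<in>multi_indices (enat k). \<bar>partial_deriv \<beta> h y\<bar> \<le> B) \<longrightarrow>
      (\<forall>x. norm (partial_deriv \<alpha> (\<lambda>x. h (\<Phi> p x) *\<^sub>R c p x) x) \<le> C * B))"
      using partial_deriv_supported_bound[OF S T \<Phi>T compact_cball K(1) c0 \<Phi> c \<alpha>] by simp
    from bchoice[OF this] obtain C where C: "\<And>p. p \<in> I \<Longrightarrow> C p \<ge> 0"
      "\<And>p h B x. p \<in> I \<Longrightarrow> B \<ge> 0 \<Longrightarrow> Ck_on (enat k) (?T p) h \<Longrightarrow>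
      (\<forall>y\<in>\<Phi> p ` ?K p. \<forall>\<beta>\<in>multi_indices (enat k). \<bar>partial_deriv \<beta> h y\<bar> \<le> B) \<Longrightarrow>
      norm (partial_deriv \<alpha> (\<lambda>x. h (\<Phi> p x) *\<^sub>R c p x) x) \<le> C p * B"
      by blast
    show ?thesis
    proof (intro exI[of _ "\<Sum>p\<in>I. C p"] conjI allI impI sum_nonneg C(1))
      fix f B x assume B: "0 \<le> B" and f: "?P f" and q: "\<forall>q\<in>Q. q f \<le> B"
      have "norm (partial_deriv \<alpha> (\<lambda>x. H f p (\<Phi> p x) *\<^sub>R c p x) x) \<le> C p * B" if p: "p \<in> I" for p
      proof (intro C(2)[OF p B H[OF f p]] ballI)
        fix y and \<beta> :: "'a list" assume y: "y \<in> \<Phi> p ` ?K p" and \<beta>: "\<beta> \<in> multi_indices (enat k)"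
        have sub: "\<Phi> p ` ?K p \<subseteq> ?T p"
          using K(1)[OF p] \<Phi>T[OF p] by blast
        have "continuous_on (\<Phi> p ` ?K p) (partial_deriv \<beta> (H f p))"
          by (rule continuous_on_subset[OF Ck_on_partial_continuous[OF H[OF f p] \<beta>] sub])
        from norm_le_sup_seminorm[OF cK[OF p] this y]
        have "\<bar>partial_deriv \<beta> (H f p) y\<bar> \<le> sup_seminorm (\<Phi> p ` ?K p) \<beta> (H f p)" by simp
        moreover have "(\<lambda>f. sup_seminorm (\<Phi> p ` ?K p) \<beta> (\<lambda>y. f (\<psi> p (flatten y)))) \<in> Q"
          unfolding Q_def using p \<beta> by force
        from q[rule_format, OF this] have "sup_seminorm (\<Phi> p ` ?K p) \<beta> (H f p) \<le> B"
          by (simp add: H_def[abs_def])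
        ultimately show "\<bar>partial_deriv \<beta> (H f p) y\<bar> \<le> B" by linarith
      qed
      then have "norm (\<Sum>p\<in>I. partial_deriv \<alpha> (\<lambda>x. H f p (\<Phi> p x) *\<^sub>R c p x) x) \<le> (\<Sum>p\<in>I. C p * B)"
        by (rule sum_norm_le)
      moreover have "partial_deriv \<alpha> (E f) x = (\<Sum>p\<in>I. partial_deriv \<alpha> (\<lambda>x. H f p (\<Phi> p x) *\<^sub>R c p x) x)"
        unfolding E_def[abs_def] by (rule partial_deriv_sum[OF open_UNIV summand[OF f] \<alpha> UNIV_I])
      ultimately show "norm (partial_deriv \<alpha> (E f) x) \<le> (\<Sum>p\<in>I. C p) * B"
        by (simp add: sum_distrib_right)
    qed
  qed
  from that[OF lin mem normal finQ subQ bound] show ?thesis by blast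
qed

section \<open>Continuity between seminorm topologies\<close>

text \<open>It suffices to test the generating balls. Such a ball is centred at some
  \<open>w0\<close> other than \<open>E f\<close> in general, so the triangle inequality first fits
  a ball around \<open>E f\<close> into it. The estimate then needs finitely many source seminorms,
  whose balls have an open intersection.\<close>

lemma continuous_map_seminorm_topology:
  fixes E :: "('x \<Rightarrow> 'y::real_normed_vector) \<Rightarrow> 'z \<Rightarrow> 'w::real_normed_vector"
  assumes maps: "\<And>f. f \<in> V \<Longrightarrow> E f \<in> W"
    and triangle: "\<And>p u v w. p \<in> PW \<Longrightarrow> u \<in> W \<Longrightarrow> v \<in> W \<Longrightarrow> w \<in> W \<Longrightarrow>
      p (\<lambda>x. u x - w x) \<le> p (\<lambda>x. u x - v x) + p (\<lambda>x. v x - w x)"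
    and est: "\<And>p. p \<in> PW \<Longrightarrow> \<exists>Q C. finite Q \<and> Q \<subseteq> PV \<and> C \<ge> 0 \<and>
      (\<forall>f\<in>V. \<forall>g\<in>V. \<forall>B\<ge>0. (\<forall>q\<in>Q. q (\<lambda>x. f x - g x) \<le> B) \<longrightarrow> p (\<lambda>x. E f x - E g x) \<le> C * B)"
    and zero: "\<And>q. q \<in> PV \<Longrightarrow> q (\<lambda>x. 0) = 0"
  shows "continuous_map (seminorm_topology V PV) (seminorm_topology W PW) E"
proof -
  let ?T = "seminorm_topology V PV"
  have top: "topspace ?T = V"
    unfolding seminorm_topology_def by auto
  have V: "openin ?T V"
    unfolding seminorm_topology_def by (intro topology_generated_by_Basis) simp
  have ball_open: "openin ?T {f \<in> V. q (\<lambda>x. f x - f0 x) < \<epsilon>}" if "q \<in> PV" "f0 \<in> V" "\<epsilon> > 0" for q f0 \<epsilon>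
    unfolding seminorm_topology_def by (intro topology_generated_by_Basis) (use that in blast)
  have pre: "openin ?T (E -` {w \<in> W. p (\<lambda>x. w x - w0 x) < \<epsilon>} \<inter> V)" if p: "p \<in> PW" "w0 \<in> W" for p w0 \<epsilon>
  proof (subst openin_subopen, intro ballI)
    fix f assume "f \<in> E -` {w \<in> W. p (\<lambda>x. w x - w0 x) < \<epsilon>} \<inter> V"
    then have f: "f \<in> V" "p (\<lambda>x. E f x - w0 x) < \<epsilon>" by auto
    obtain Q C where Q: "finite Q" "Q \<subseteq> PV" "C \<ge> 0"
      "\<And>f g B. f \<in> V \<Longrightarrow> g \<in> V \<Longrightarrow> B \<ge> 0 \<Longrightarrow> (\<forall>q\<in>Q. q (\<lambda>x. f x - g x) \<le> B) \<Longrightarrow>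
        p (\<lambda>x. E f x - E g x) \<le> C * B"
      using est[OF p(1)] by auto
    define e where "e = \<epsilon> - p (\<lambda>x. E f x - w0 x)"
    \<comment> \<open>The summand 1 avoids division by 0 and makes \<open>C * \<delta>\<close>
      strictly smaller than the remaining gap \<open>e\<close>.\<close>
    define \<delta> where "\<delta> = e / (C + 1)"
    have e: "e > 0" "\<delta> > 0" using f Q(3) by (auto simp: e_def \<delta>_def)
    have "C * \<delta> < e" using e Q(3) by (simp add: \<delta>_def field_simps)
    let ?N = "\<Inter>(insert V ((\<lambda>q. {g \<in> V. q (\<lambda>x. g x - f x) < \<delta>}) ` Q))"
    have "openin ?T ?N"
      using Q(1,2) V ball_open[OF _ f(1) e(2)] by (intro openin_Inter) auto
    moreover have "q (\<lambda>x. f x - f x) < \<delta>" if "q \<in> Q" for q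
      using zero[OF subsetD[OF Q(2) that]] e(2) by simp
    then have "f \<in> ?N" using f(1) by blast
    moreover have "?N \<subseteq> E -` {w \<in> W. p (\<lambda>x. w x - w0 x) < \<epsilon>} \<inter> V"
    proof
      fix g assume g: "g \<in> ?N"
      then have gV: "g \<in> V" by simp
      have "p (\<lambda>x. E g x - E f x) \<le> C * \<delta>"
        using g e(2) by (intro Q(4) gV f(1)) auto
      moreover have "p (\<lambda>x. E g x - w0 x) \<le> p (\<lambda>x. E g x - E f x) + p (\<lambda>x. E f x - w0 x)"
        by (intro triangle p maps gV f(1))
      ultimately have "p (\<lambda>x. E g x - w0 x) < \<epsilon>"
        using \<open>C * \<delta> < e\<close> by (simp add: e_def)
      then show "g \<in> E -` {w \<in> W. p (\<lambda>x. w x - w0 x) < \<epsilon>} \<inter> V"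
        using gV maps by simp
    qed
    ultimately show "\<exists>T. openin ?T T \<and> f \<in> T \<and> T \<subseteq> E -` {w \<in> W. p (\<lambda>x. w x - w0 x) < \<epsilon>} \<inter> V"
      by blast
  qed
  show ?thesis
    unfolding seminorm_topology_def[of W]
  proof (rule continuous_on_generated_topo)
    fix U assume "U \<in> insert W {{f \<in> W. p (\<lambda>x. f x - f0 x) < \<epsilon>} |p f0 \<epsilon>. p \<in> PW \<and> f0 \<in> W \<and> 0 < \<epsilon>}"
    then consider "U = W" | p w0 \<epsilon> where "U = {w \<in> W. p (\<lambda>x. w x - w0 x) < \<epsilon>}" "p \<in> PW" "w0 \<in> W"
      by blast
    then show "openin ?T (E -` U \<inter> topspace ?T)"
    proof cases
      case 1
      then have "E -` U \<inter> V = V" using maps by auto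
      then show ?thesis using V top by simp
    next
      case 2
      then show ?thesis using pre top by simp
    qed
  next
    show "E ` topspace ?T \<subseteq> \<Union>(insert W {{f \<in> W. p (\<lambda>x. f x - f0 x) < \<epsilon>} |p f0 \<epsilon>. p \<in> PW \<and> f0 \<in> W \<and> 0 < \<epsilon>})"
      using maps top by auto
  qed
qed

lemma Ckc_diff:
  fixes X Y :: "'a::euclidean_space \<Rightarrow> 'a"
  assumes "X \<in> Ckc (enat k) D" "Y \<in> Ckc (enat k) D"
  shows "(\<lambda>x. X x - Y x) \<in> Ckc (enat k) D"
proof -
  let ?Z = "closure {x. X x - Y x \<noteq> 0}" and ?K = "closure {x. X x \<noteq> 0} \<union> closure {x. Y x \<noteq> 0}"
  have "{x. X x - Y x \<noteq> 0} \<subseteq> {x. X x \<noteq> 0} \<union> {x. Y x \<noteq> 0}" by auto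
  then have sub: "?Z \<subseteq> ?K"
    using closure_mono closure_Un by metis
  moreover have "compact ?K" using assms by (auto simp: Ckc_def)
  ultimately have "compact ?Z"
    using compact_Int_closed[of ?K ?Z] by (simp add: Int_absorb1)
  moreover have "?Z \<subseteq> D" using sub assms by (auto simp: Ckc_def)
  moreover have "Ck_on (enat k) UNIV (\<lambda>x. X x - Y x)"
    using assms by (intro Ck_on_diff) (auto simp: Ckc_def)
  ultimately show ?thesis by (simp add: Ckc_def)
qed

lemma boundary_Ck_diff:
  assumes "boundary_Ck m (enat k) M f" "boundary_Ck m (enat k) M g"
  shows "boundary_Ck m (enat k) M (\<lambda>p. f p - g p)"
  unfolding boundary_Ck_def
proof (intro allI impI)
  fix U V \<phi> \<psi> assume ch: "submfd_chart m M U V \<phi> \<psi>"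
  show "Ck_on (enat k) (flatten -` V) (\<lambda>y. f (\<psi> (flatten y)) - g (\<psi> (flatten y)))"
    using assms ch by (intro Ck_on_diff open_flatten_vimage submfd_chartD(2)[OF ch]) (auto simp: boundary_Ck_def)
qed

text \<open>On the frontier the normal agrees with \<open>- sgn (chart_grad \<phi>)\<close>, which
  is of class C^k on all of \<open>U\<close>, and the points \<open>\<psi> (flatten y)\<close> lie
  on the frontier. The gradient costs one derivative, hence the order \<open>Suc k\<close> of
  \<open>M\<close>.\<close>

lemma boundary_Ck_normal_component:
  fixes X :: "'a::euclidean_space \<Rightarrow> 'a"
  assumes "closed M" "submanifold (enat (Suc k)) M" "Ck_on (enat k) UNIV X"
  shows "boundary_Ck (enat (Suc k)) (enat k) M
    (\<lambda>p\<in>mfd_boundary (enat (Suc k)) M. X p \<bullet> outward_unit_normal (enat (Suc k)) M p)"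
  unfolding boundary_Ck_def
proof (intro allI impI)
  fix U V \<phi> \<psi> assume ch: "submfd_chart (enat (Suc k)) M U V \<phi> \<psi>"
  note chD = submfd_chartD[OF ch]
  let ?n = "\<lambda>x. X x \<bullet> ((- inverse (norm (chart_grad \<phi> x))) *\<^sub>R chart_grad \<phi> x)"
  have n: "Ck_on (enat k) U ?n"
    using chart_grad_nonzero[OF ch]
    by (intro Ck_on_inner chD(1) Ck_on_subset[OF assms(3)] Ck_on_scaleR
        Ck_on_linear_compose[OF chD(1) bounded_linear_minus[OF bounded_linear_ident]]
        Ck_on_inverse_norm Ck_on_chart_grad[OF ch]) auto
  have T: "open (flatten -` V)" by (rule open_flatten_vimage[OF chD(2)])
  have \<psi>: "Ck_on (enat k) V \<psi>" by (rule Ck_on_mono[OF chD(4)]) simp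
  have \<psi>f: "Ck_on (enat k) (flatten -` V) (\<lambda>y. \<psi> (flatten y))"
    by (rule Ck_on_compose[OF T chD(2) _ \<psi> Ck_on_bounded_linear[OF bounded_linear_flatten]]) simp
  have n\<psi>: "Ck_on (enat k) (flatten -` V) (\<lambda>y. ?n (\<psi> (flatten y)))"
    by (rule Ck_on_compose[OF T chD(1) _ n \<psi>f]) (simp add: chD(6))
  show "Ck_on (enat k) (flatten -` V) (\<lambda>y. (\<lambda>p\<in>mfd_boundary (enat (Suc k)) M.
      X p \<bullet> outward_unit_normal (enat (Suc k)) M p) (\<psi> (flatten y)))"
  proof (rule Ck_on_cong_open[OF T _ n\<psi>])
    fix y assume "y \<in> flatten -` V"
    then have y: "\<psi> (flatten y) \<in> U" "\<phi> (\<psi> (flatten y)) \<bullet> last_axis = 0"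
      using chD(6,8) by auto
    then have "\<psi> (flatten y) \<in> mfd_boundary (enat (Suc k)) M"
      using chart_frontier_iff[OF ch] by (simp add: mfd_boundary_eq_frontier[OF assms(1,2)])
    then show "?n (\<psi> (flatten y)) = (\<lambda>p\<in>mfd_boundary (enat (Suc k)) M.
      X p \<bullet> outward_unit_normal (enat (Suc k)) M p) (\<psi> (flatten y))"
      by (simp add: outward_unit_normal_chart[OF ch y] sgn_div_norm)
  qed
qed

lemma sup_seminorm_zero:
  "sup_seminorm K \<alpha> (\<lambda>x::'a::euclidean_space. 0::'b::real_normed_vector) = 0"
proof -
  have "insert 0 ((\<lambda>x. norm (partial_deriv \<alpha> (\<lambda>x::'a. 0::'b) x)) ` K) = {0::real}"
    by (auto simp: partial_deriv_zero)
  then show ?thesis by (simp only: sup_seminorm_def cSup_singleton)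
qed

lemma continuous_map_extension:
  fixes E :: "('a::euclidean_space \<Rightarrow> real) \<Rightarrow> 'a \<Rightarrow> 'a"
  assumes diff: "\<And>f g. E (\<lambda>p. f p - g p) = (\<lambda>x. E f x - E g x)"
    and mem: "\<And>f. boundary_Ck m (enat k) M f \<Longrightarrow> E f \<in> Ckc (enat k) D"
    and Q: "finite Q" "Q \<subseteq> boundary_seminorms m (enat k) M"
    and est: "\<And>\<alpha>. \<alpha> \<in> multi_indices (enat k) \<Longrightarrow> \<exists>C\<ge>0. \<forall>f. \<forall>B\<ge>0. boundary_Ck m (enat k) M f \<longrightarrow>
      (\<forall>q\<in>Q. q f \<le> B) \<longrightarrow> (\<forall>x. norm (partial_deriv \<alpha> (E f) x) \<le> C * B)"
  shows "continuous_map (Ck_boundary_topology m (enat k) M) (Ckc_topology (enat k) D) E"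
  unfolding Ck_boundary_topology_def Ckc_topology_def
proof (rule continuous_map_seminorm_topology, fold boundary_seminorms_def)
  show "E f \<in> Ckc (enat k) D" if "f \<in> Ck_boundary m (enat k) M" for f
    using that by (intro mem) (simp add: Ck_boundary_eq)
next
  fix p :: "('a \<Rightarrow> 'a) \<Rightarrow> real" and u v w :: "'a \<Rightarrow> 'a"
  assume "p \<in> {sup_seminorm K \<alpha> |K \<alpha>. compact K \<and> K \<subseteq> D \<and> \<alpha> \<in> multi_indices (enat k)}"
    and uvw: "u \<in> Ckc (enat k) D" "v \<in> Ckc (enat k) D" "w \<in> Ckc (enat k) D"
  then obtain K \<alpha> where p: "p = sup_seminorm K \<alpha>" "compact K" "\<alpha> \<in> multi_indices (enat k)" by blast
  have "Ck_on (enat k) UNIV (\<lambda>x. u x - v x)" "Ck_on (enat k) UNIV (\<lambda>x. v x - w x)"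
    using uvw by (auto intro!: Ck_on_diff simp: Ckc_def)
  from sup_seminorm_triangle[OF this p(2,3)]
  show "p (\<lambda>x. u x - w x) \<le> p (\<lambda>x. u x - v x) + p (\<lambda>x. v x - w x)"
    by (simp add: p(1))
next
  fix p :: "('a \<Rightarrow> 'a) \<Rightarrow> real"
  assume "p \<in> {sup_seminorm K \<alpha> |K \<alpha>. compact K \<and> K \<subseteq> D \<and> \<alpha> \<in> multi_indices (enat k)}"
  then obtain K \<alpha> where p: "p = sup_seminorm K \<alpha>" "\<alpha> \<in> multi_indices (enat k)" by blast
  obtain C where C: "C \<ge> 0" "\<And>f B x. B \<ge> 0 \<Longrightarrow> boundary_Ck m (enat k) M f \<Longrightarrow> (\<forall>q\<in>Q. q f \<le> B) \<Longrightarrow>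
      norm (partial_deriv \<alpha> (E f) x) \<le> C * B"
    using est[OF p(2)] by blast
  have "p (\<lambda>x. E f x - E g x) \<le> C * B"
    if "f \<in> Ck_boundary m (enat k) M" "g \<in> Ck_boundary m (enat k) M" "B \<ge> 0"
      "\<forall>q\<in>Q. q (\<lambda>x. f x - g x) \<le> B" for f g B
    \<comment> \<open>Linearity moves the difference inside \<open>E\<close>, so the bound for a
      single function applies to f - g, which satisfies \<open>boundary_Ck\<close> though it may
      fail to be extensional.\<close>
    unfolding p(1) diff[symmetric]
    using that C by (intro sup_seminorm_le C(2) boundary_Ck_diff) (auto simp: Ck_boundary_eq)
  then show "\<exists>Q C. finite Q \<and> Q \<subseteq> boundary_seminorms m (enat k) M \<and> C \<ge> 0 \<and>
      (\<forall>f\<in>Ck_boundary m (enat k) M. \<forall>g\<in>Ck_boundary m (enat k) M. \<forall>B\<ge>0.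
        (\<forall>q\<in>Q. q (\<lambda>x. f x - g x) \<le> B) \<longrightarrow> p (\<lambda>x. E f x - E g x) \<le> C * B)"
    using Q C(1) by (intro exI[of _ Q] exI[of _ C]) simp
next
  show "q (\<lambda>x. 0) = 0" if "q \<in> boundary_seminorms m (enat k) M" for q
    using that by (auto simp: boundary_seminorms_def sup_seminorm_zero)
qed

theorem corollary5p7:
  fixes k :: nat and D M :: "'a::euclidean_space set"
    and \<Xi> :: "'a set set" and J :: "'a set \<Rightarrow> real"
  assumes "k \<ge> 1"
    and "open D" and "bounded D"
    and "M \<subseteq> D" and "closed M" and "bounded M" and "submanifold (enat (k + 1)) M"
    and "\<And>N. N \<in> \<Xi> \<Longrightarrow> closed N \<and> bounded N \<and> submanifold (enat k) N \<and> N \<subseteq> D"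
    and "M \<in> \<Xi>"
    and "shape_differentiable D \<Xi> J M"
    and "shape_deriv_of_order k D \<Xi> J M"
  shows "\<exists>g :: ('a \<Rightarrow> real) \<Rightarrow> real.
      linear_functional_on (mfd_boundary (enat (k + 1)) M) (Ck_boundary (enat (k + 1)) (enat k) M) g \<and>
      continuous_map (Ck_boundary_topology (enat (k + 1)) (enat k) M) euclideanreal g \<and>
      (\<forall>X \<in> Ckc (enat k) D. eulerian_semideriv J M X =
         g (\<lambda>p \<in> mfd_boundary (enat (k + 1)) M. X p \<bullet> outward_unit_normal (enat (k + 1)) M p))"
proof -
  obtain n where k: "k = Suc n" using assms(1) by (cases k) auto
  have M: "submanifold (enat (Suc k)) M" using assms(7) by simp
  have bd: "mfd_boundary (enat (Suc k)) M = frontier M"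
    by (rule mfd_boundary_eq_frontier[OF assms(5) M])
  let ?\<nu> = "outward_unit_normal (enat (Suc k)) M"
  let ?l = "eulerian_semideriv J M"
  obtain E Q where
    lin: "\<And>f g h a b. (\<And>p. p \<in> frontier M \<Longrightarrow> h p = a * f p + b * g p) \<Longrightarrow> E h = (\<lambda>x. a *\<^sub>R E f x + b *\<^sub>R E g x)"
    and mem: "\<And>f. boundary_Ck (enat (Suc k)) (enat k) M f \<Longrightarrow> E f \<in> Ckc (enat k) D"
    and normal: "\<And>f p. p \<in> frontier M \<Longrightarrow> E f p \<bullet> ?\<nu> p = f p"
    and Q: "finite Q" "Q \<subseteq> boundary_seminorms (enat (Suc k)) (enat k) M"
    "\<And>\<alpha>. \<alpha> \<in> multi_indices (enat k) \<Longrightarrow> \<exists>C\<ge>0. \<forall>f. \<forall>B\<ge>0. boundary_Ck (enat (Suc k)) (enat k) M f \<longrightarrow>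
      (\<forall>q\<in>Q. q f \<le> B) \<longrightarrow> (\<forall>x. norm (partial_deriv \<alpha> (E f) x) \<le> C * B)"
    using extension_operator[OF assms(2,4,5,6) M] by blast
  \<comment> \<open>The convention on the order supplies the derivative on all C^k fields;
    \<open>E f\<close> is in general no smoother.\<close>
  have l: "linear_functional_on UNIV (Ckc (enat k) D) ?l"
    "continuous_map (Ckc_topology (enat k) D) euclideanreal ?l"
    using assms(1,11) by (auto simp: shape_deriv_of_order_def differentiable_on_Ckc_def)
  have l_lin: "?l (\<lambda>x. a *\<^sub>R X x + b *\<^sub>R Y x) = a * ?l X + b * ?l Y"
    if "X \<in> Ckc (enat k) D" "Y \<in> Ckc (enat k) D" for X Y a b
    using l(1)[unfolded linear_functional_on_def restrict_UNIV] that by blast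
  have diff: "E (\<lambda>p. f p - g p) = (\<lambda>x. E f x - E g x)" for f g
    using lin[of "\<lambda>p. f p - g p" 1 f "-1" g] by simp
  have "linear_functional_on (frontier M) (Ck_boundary (enat (Suc k)) (enat k) M) (\<lambda>f. ?l (E f))"
    unfolding linear_functional_on_def
  proof (intro ballI allI)
    fix f g and a b :: real
    assume "f \<in> Ck_boundary (enat (Suc k)) (enat k) M" "g \<in> Ck_boundary (enat (Suc k)) (enat k) M"
    then have "E f \<in> Ckc (enat k) D" "E g \<in> Ckc (enat k) D"
      by (auto intro: mem simp: Ck_boundary_eq)
    \<comment> \<open>Off the frontier the restricted function is \<open>undefined\<close>;
      \<open>E\<close> reads frontier values only, so the linear relation there suffices.\<close>
    moreover have "E (\<lambda>x\<in>frontier M. a *\<^sub>R f x + b *\<^sub>R g x) = (\<lambda>x. a *\<^sub>R E f x + b *\<^sub>R E g x)"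
      by (rule lin) simp
    ultimately show "?l (E (\<lambda>x\<in>frontier M. a *\<^sub>R f x + b *\<^sub>R g x)) = a * ?l (E f) + b * ?l (E g)"
      by (simp add: l_lin)
  qed
  moreover have "continuous_map (Ck_boundary_topology (enat (Suc k)) (enat k) M) euclideanreal (\<lambda>f. ?l (E f))"
    using continuous_map_compose[OF continuous_map_extension[OF diff mem Q] l(2)] by (simp add: o_def)
  moreover have "?l X = ?l (E (\<lambda>p\<in>frontier M. X p \<bullet> ?\<nu> p))" if X: "X \<in> Ckc (enat k) D" for X
  proof -
    let ?f = "\<lambda>p\<in>frontier M. X p \<bullet> ?\<nu> p"
    have "boundary_Ck (enat (Suc k)) (enat k) M ?f"
      using boundary_Ck_normal_component[OF assms(5) M, of X] X by (simp add: bd Ckc_def)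
    then have E: "E ?f \<in> Ckc (enat k) D" by (rule mem)
    \<comment> \<open>\<open>X\<close> and \<open>E ?f\<close> have the same normal component on the
      frontier, so their difference is tangential. Writing \<open>k\<close> as \<open>Suc n\<close>
      provides the order at least 1 that the flow argument needs.\<close>
    have "?l (\<lambda>x. X x - E ?f x) = 0"
    proof (rule eulerian_semideriv_tangential[where n=n and D=D, folded k])
      show "(X p - E ?f p) \<bullet> ?\<nu> p = 0" if "p \<in> frontier M" for p
        using normal[OF that, of ?f] that by (simp add: inner_diff_left)
    qed (use assms(5) M Ckc_diff[OF X E] in auto)
    then show ?thesis
      using l_lin[OF X E, of 1 "-1"] by simp
  qed
  ultimately show ?thesis
    unfolding Suc_eq_plus1[symmetric] bd by blast
qed

end
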